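(* The 600-cell has exactly eight fifteen-fold parity proofs, namely those described by the words $a$, $b$, $acd$, $ace$, $ade$, $bcd$, $bce$, $bde$. The proofs $a$ and $b$ each have ray-basis symbol $30_2-15_4$ and are irreducible; the other six each have ray-basis symbol $30_2 30_4-45_4$ and are reducible.
   Context: The 600-cell is the regular polytope $\{3,3,5\}$ in $\mathbb{R}^4$ with 120 vertices, centered at the origin. Its rays are the 60 undirected lines through antipodal pairs of vertices, and a basis is a set of four mutually orthogonal rays. In the triacontagonal projection (projection to the Coxeter plane of $H_4$) the rays, represented by one of each pair of antipodal vertices, lie at the vertices of four concentric regular 15-gons (pentadecagons), and they are numbered $A$: 1–15, $B$: 16–30, $C$: 31–45, $D$: 46–60, in order of decreasing circumradius, counterclockwise around each pentadecagon, starting from the ray on or just above the positive $x$-axis. Rotation by $24^\circ$ in the projection plane is induced by a symmetry $g$ of the 600-cell that sends each ray to the ray numbered one higher, with wraparound inside its pentadecagon (so $15\mapsto 1$, $30\mapsto 16$, $45\mapsto 31$, $60\mapsto 46$). With this numbering, the 75 bases of the 600-cell are the $g$-orbits (fifteen bases each, obtained by repeatedly adding one to each ray number with wraparound) of the five generators $a=\{1,5,55,56\}$, $b=\{16,18,36,43\}$, $c=\{1,19,43,49\}$, $d=\{1,20,41,58\}$, $e=\{1,27,42,46\}$. A word in distinct letters from $a,b,c,d,e$ denotes the union of the orbits of the corresponding generators. A parity proof is a set of bases consisting of an odd number of bases such that each ray occurs in an even number (possibly zero) of the bases of the set. It is fifteen-fold if it is invariant under $g$. It is irreducible if no proper subset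 of its bases is a parity proof of any kind (even one that is not $g$-invariant), and reducible otherwise. The ray-basis symbol $p_m q_n\cdots-b_4$ of a proof means that $p$ rays occur in exactly $m$ bases of the proof, $q$ rays in exactly $n$ bases, and so on, and the proof consists of $b$ bases of 4 rays each. *)

theory Defs
  imports "HOL-Analysis.Analysis"
begin

section \<open>The 600-cell, its rays and its bases\<close>

definition golden :: real where
  "golden = (1 + sqrt 5) / 2"

text \<open>The standard vertices, of circumradius 1: the permutations of (\<plusminus>1, 0, 0, 0), all
  (\<plusminus>1/2, \<plusminus>1/2, \<plusminus>1/2, \<plusminus>1/2), and the even permutations of
  (\<plusminus>golden/2, \<plusminus>1/2, \<plusminus>1/(2 golden), 0).\<close>

definition vertices :: "(real ^ 4) set" where
  "vertices =
     {axis i s | i s. s \<in> {1, - 1}}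
   \<union> {v. \<forall>i. v $ i \<in> {1 / 2, - 1 / 2}}
   \<union> {(\<chi> i. vector [s1 * golden / 2, s2 / 2, s3 / (2 * golden), 0] $ \<sigma> i) | \<sigma> s1 s2 s3.
        \<sigma> permutes (UNIV :: 4 set) \<and> evenperm \<sigma> \<and>
        s1 \<in> {1, - 1} \<and> s2 \<in> {1, - 1} \<and> s3 \<in> {1, - 1}}"

type_synonym ray = "(real ^ 4) set"

definition rays :: "ray set" where
  "rays = {span {v} | v. v \<in> vertices}"

definition orthogonal_rays :: "ray \<Rightarrow> ray \<Rightarrow> bool" where
  "orthogonal_rays R S \<longleftrightarrow> (\<forall>x\<in>R. \<forall>y\<in>S. orthogonal x y)"

definition bases :: "ray set set" where
  "bases = {B. B \<subseteq> rays \<and> card B = 4 \<and> pairwise orthogonal_rays B}"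

definition symmetry :: "(real ^ 4 \<Rightarrow> real ^ 4) \<Rightarrow> bool" where
  "symmetry f \<longleftrightarrow> orthogonal_transformation f \<and> f ` vertices = vertices"


section \<open>The triacontagonal projection\<close>

text \<open>Identify \<open>real ^ 4\<close> with the quaternions, the first coordinate being the real part, and let
  \<open>u\<close>, \<open>w\<close> be the unit imaginary quaternions along (golden, 1, 0) and (1, 1, 1).  The Coxeter plane
  used here is the plane of all \<open>x\<close> with \<open>u x = x w\<close>.  It is spanned by the orthogonal vectors
  \<open>1 - u w\<close> and \<open>u + w = u (1 - u w)\<close> of equal length.  The symmetry
  \<open>x \<mapsto> exp (- pi u / 5) x exp (pi w / 3)\<close> of the 600-cell turns this plane by 24 degrees and the
  orthogonal plane by 96 degrees; minus its eighth power is a Coxeter element (of order 30), which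
  turns this plane by 12 degrees.  The vertex 1 lies in the outermost ring and is projected onto the
  positive x-axis.\<close>

definition plane_x :: "real ^ 4" where
  "plane_x = (let k = 1 / (sqrt 3 * sqrt (golden + 2)) in
     vector [1 + k * golden\<^sup>2, - k, k * golden, - k / golden])"

definition plane_y :: "real ^ 4" where
  "plane_y = (let s = 1 / sqrt (golden + 2); t = 1 / sqrt 3 in
     vector [0, s * golden + t, s + t, t])"

definition coxeter_proj :: "real ^ 4 \<Rightarrow> complex" where
  "coxeter_proj x = Complex (x \<bullet> plane_x / norm plane_x) (x \<bullet> plane_y / norm plane_y)"

text \<open>The symmetry inducing the rotation by 24 degrees; it is unique because
  \<^const>\<open>coxeter_proj\<close> is injective on the vertices, which span the space.\<close>

definition g :: "real ^ 4 \<Rightarrow> real ^ 4" where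
  "g = (THE f. symmetry f \<and> (\<forall>x. coxeter_proj (f x) = cis (2 * pi / 15) * coxeter_proj x))"


section \<open>The numbering of the rays\<close>

text \<open>The 120 vertices are projected to four concentric regular 30-gons, numbered 0, 1, 2, 3 (for
  A, B, C, D) by decreasing circumradius.  Each of them consists of two antipodal pentadecagons;
  the one that represents the rays is the one containing the vertex on or just above the positive
  x-axis, i.e. the only one of the 30 vertices with argument in [0, 12 degrees).\<close>

definition circumradius :: "nat \<Rightarrow> real" where
  "circumradius q = rev (sorted_list_of_set ((\<lambda>v. cmod (coxeter_proj v)) ` vertices)) ! q"

definition start_vertex :: "nat \<Rightarrow> real ^ 4" where
  "start_vertex q = (THE v. v \<in> vertices \<and> cmod (coxeter_proj v) = circumradius q \<and>
     0 \<le> Arg (coxeter_proj v) \<and> Arg (coxeter_proj v) < pi / 15)"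

definition numbered_vertex :: "nat \<Rightarrow> real ^ 4" where
  "numbered_vertex n = (THE v. v \<in> vertices \<and>
     coxeter_proj v =
       cis (2 * pi * real ((n - 1) mod 15) / 15) * coxeter_proj (start_vertex ((n - 1) div 15)))"

definition ray :: "nat \<Rightarrow> ray" where
  "ray n = span {numbered_vertex n}"

definition next_number :: "nat \<Rightarrow> nat" where
  "next_number n = (if n mod 15 = 0 then n - 14 else n + 1)"


section \<open>Generators and words\<close>

datatype letter = La | Lb | Lc | Ld | Le

fun generator :: "letter \<Rightarrow> nat set" where
  "generator La = {1, 5, 55, 56}"
| "generator Lb = {16, 18, 36, 43}"
| "generator Lc = {1, 19, 43, 49}"
| "generator Ld = {1, 20, 41, 58}"
| "generator Le = {1, 27, 42, 46}"

definition orbit_of :: "letter \<Rightarrow> ray set set" where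
  "orbit_of l = {ray ` (next_number ^^ k) ` generator l | k. True}"

definition word :: "letter list \<Rightarrow> ray set set" where
  "word ls = (\<Union>l\<in>set ls. orbit_of l)"


section \<open>Parity proofs\<close>

definition occurrences :: "ray set set \<Rightarrow> ray \<Rightarrow> nat" where
  "occurrences S R = card {B \<in> S. R \<in> B}"

definition parity_proof :: "ray set set \<Rightarrow> bool" where
  "parity_proof S \<longleftrightarrow> S \<subseteq> bases \<and> odd (card S) \<and> (\<forall>R\<in>rays. even (occurrences S R))"

definition fifteen_fold :: "ray set set \<Rightarrow> bool" where
  "fifteen_fold S \<longleftrightarrow> (\<lambda>B. (\<lambda>R. g ` R) ` B) ` S = S"

definition irreducible_proof :: "ray set set \<Rightarrow> bool" where
  "irreducible_proof S \<longleftrightarrow> parity_proof S \<and> \<not> (\<exists>T. T \<subset> S \<and> parity_proof T)"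

definition reducible_proof :: "ray set set \<Rightarrow> bool" where
  "reducible_proof S \<longleftrightarrow> parity_proof S \<and> \<not> irreducible_proof S"

text \<open>A symbol is a pair of sets: (p, m) in the first one is the entry \<open>p\<^sub>m\<close> (exactly p > 0 rays
  occur in exactly m > 0 bases), and (b, k) in the second one is the entry \<open>b\<^sub>k\<close> (exactly b > 0
  of the bases consist of k rays).\<close>

definition ray_basis_symbol :: "ray set set \<Rightarrow> (nat \<times> nat) set \<times> (nat \<times> nat) set" where
  "ray_basis_symbol S =
     ({(p, m). 0 < p \<and> 0 < m \<and> p = card {R \<in> rays. occurrences S R = m}},
      {(b, k). 0 < b \<and> b = card {B \<in> S. card B = k}})"

end

theory Submission
  imports Defs
begin

text \<open>The 24-degree rotation is the quaternionic map x \<open>\<mapsto>\<close> exp (- pi u / 5) x exp (pi w / 3), half of a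
  matrix over the golden integers Z[golden]; its iterates on four start vertices and their negatives are all 120 vertices,
  so that the numbering and orthogonality become exact integer computations, and the 75 bases are
  the 4-cliques of the orthogonality relation.

  A fifteen-fold set of bases is a union of orbits of generators, and by symmetry only the number of
  rays that each generator has in each of the four rings A, B, C, D matters: (2,0,0,2) for a,
  (0,2,2,0) for b, and (1,1,1,1) for c, d, e.  Parity in the rings forces an even number of letters
  among c, d, e, and an odd number of bases then forces exactly one of a, b.

  In a and in b each ray occurs twice or never, so that a parity proof inside the orbit contains with
  a basis also every basis sharing a ray with it.  Bases at distance 4 (for a) or 2 (for b) along the
  orbit share a ray, and 4 and 2 are coprime to 15; hence a and b are irreducible.  The other six
  proofs properly contain a or b.\<close>

section \<open>Golden ratio and Coxeter plane\<close>

text \<open>The obstacle is that the numbering is defined through real geometry: moduli sorted by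
  size, values of \<open>Arg\<close>, and definite descriptions of vertices and of \<open>g\<close>.
  Two facts turn this into arithmetic modulo 15. The four ring radii are distinct, and inside a ring
  the projected vertices are a start point times the numbers plus or minus
  \<open>cis (2 * pi * k / 15)\<close>, which are the 30 different 30th roots of unity. So
  \<open>coxeter_proj\<close> is injective on the vertices and each description has exactly one
  solution. The coordinates that occur on the way lie in the field generated by
  \<open>golden\<close>, \<open>sqrt 3\<close> and \<open>golden_pent\<close>, where identities
  follow by rewriting to a normal form; arguments are found from a reflection symmetry instead of an
  arctangent. The irrationality of \<open>golden\<close> makes integer pairs faithful: an inner
  product vanishes iff a pair of integers does.\<close>

lemma vector_4:
  "(vector [x, y, z, w] :: ('a::zero) ^ 4) $ 1 = x"
  "(vector [x, y, z, w] :: ('a::zero) ^ 4) $ 2 = y"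
  "(vector [x, y, z, w] :: ('a::zero) ^ 4) $ 3 = z"
  "(vector [x, y, z, w] :: ('a::zero) ^ 4) $ 4 = w"
  unfolding vector_def by simp_all

lemma inner_4: "(x :: real ^ 4) \<bullet> y = x $ 1 * y $ 1 + x $ 2 * y $ 2 + x $ 3 * y $ 3 + x $ 4 * y $ 4"
  by (simp add: inner_vec_def sum_4)

lemma golden_sq: "golden\<^sup>2 = golden + 1"
  by (simp add: golden_def power2_eq_square field_simps)

lemma golden_bounds: "1 < golden" "golden < 2"
proof -
  have "1 < sqrt 5" "sqrt 5 < 3" by (simp_all add: real_less_lsqrt)
  then show "1 < golden" "golden < 2" by (simp_all add: golden_def)
qed

lemma inverse_golden: "1 / golden = golden - 1"
  using golden_sq golden_bounds by (simp add: field_simps power2_eq_square)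

lemma golden_irrational: "golden \<notin> \<rat>"
proof
  assume "golden \<in> \<rat>"
  then have "2 * golden - 1 \<in> \<rat>" by simp
  moreover have "2 * golden - 1 = sqrt 5" by (simp add: golden_def field_simps)
  ultimately obtain m n where n: "n \<noteq> (0::nat)" and sq: "\<bar>sqrt 5\<bar> = real m / real n"
     and co: "coprime m n" using Rats_abs_nat_div_natE by metis
  have "real (m\<^sup>2) = real (5 * n\<^sup>2)"
    using n arg_cong[OF sq, of "\<lambda>x. x\<^sup>2"] by (simp add: power_divide field_simps)
  then have eq: "m\<^sup>2 = 5 * n\<^sup>2" by (simp only: of_nat_eq_iff)
  have p: "prime (5::nat)" by simp
  from eq have "5 dvd m\<^sup>2" by simp
  then have "5 dvd m" using p prime_dvd_power_nat by blast
  then obtain k where k: "m = 5 * k" ..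
  with eq have "n\<^sup>2 = 5 * k\<^sup>2" by (simp add: power2_eq_square)
  then have "5 dvd n" using p prime_dvd_power_nat by (metis dvd_triv_left)
  with \<open>5 dvd m\<close> co show False by (auto simp: coprime_def)
qed

lemma golden_int_combination_0:
  assumes "of_int a + of_int b * golden = 0"
  shows "a = 0 \<and> b = 0"
proof -
  have "b = 0"
  proof (rule ccontr)
    assume "b \<noteq> 0"
    then have "golden = - of_int a / of_int b" using assms by (simp add: field_simps)
    then show False using golden_irrational by (metis Rats_divide Rats_minus_iff Rats_of_int)
  qed
  with assms show ?thesis by simp
qed

text \<open>The length of (golden, 1, 0), the vector along which \<open>u\<close> points. It is also
  twice the sine of 72 degrees, which is how it enters \<open>cis_pi_15\<close>.\<close>

definition golden_pent :: real where "golden_pent = sqrt (golden + 2)"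

lemma golden_pent_sq: "golden_pent\<^sup>2 = golden + 2" "0 < golden_pent"
  using golden_bounds by (simp_all add: golden_pent_def)

lemma cos_sin_pi_5: "cos (pi / 5) = golden / 2" "sin (pi / 5) = golden_pent * (golden - 1) / 2"
proof -
  define c s where "c = cos (pi / 5)" and "s = sin (pi / 5)"
  have pos: "0 < c" "0 < s" by (auto simp: c_def s_def cos_gt_zero sin_gt_zero)
  have s2: "s\<^sup>2 = 1 - c\<^sup>2" by (simp add: c_def s_def sin_squared_eq)
  \<comment> \<open>With t = pi / 5, the angles 2t and 3t add up to pi and have the same sine;
    expanding both sides gives a quadratic equation for the cosine.\<close>
  have "sin (2 * (pi / 5)) = sin (pi - 2 * (pi / 5))" by (rule sin_pi_minus[symmetric])
  also have "pi - 2 * (pi / 5) = 2 * (pi / 5) + pi / 5" by simp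
  also have "sin \<dots> = sin (2 * (pi / 5)) * c + cos (2 * (pi / 5)) * s"
    by (simp only: sin_add c_def s_def)
  finally have "2 * s * c = 2 * s * c * c + (1 - 2 * s\<^sup>2) * s"
    by (simp only: sin_double cos_double_sin c_def[symmetric] s_def[symmetric])
  then have "s * (4 * c\<^sup>2 - 2 * c - 1) = 0"
    unfolding s2 by (simp add: algebra_simps power2_eq_square)
  then have "4 * c\<^sup>2 - 2 * c - 1 = 0" using pos by simp
  \<comment> \<open>The other root (1 - golden) / 2 is negative.\<close>
  then have "(2 * c - golden) * (2 * c + golden - 1) = 0"
    using golden_sq by (simp add: algebra_simps power2_eq_square)
  then show c: "cos (pi / 5) = golden / 2" using pos golden_bounds by (auto simp: c_def)
  have "s\<^sup>2 = (golden_pent * (golden - 1) / 2)\<^sup>2"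
    unfolding s2 using golden_sq golden_pent_sq(1) c[folded c_def]
    by (simp add: power_mult_distrib power_divide) algebra
  then show "sin (pi / 5) = golden_pent * (golden - 1) / 2"
    using pos golden_pent_sq golden_bounds unfolding s_def[symmetric]
    by (subst (asm) power2_eq_iff_nonneg) auto
qed

lemma cis_2pi_15:
  "cis (2 * pi / 15) = Complex ((golden + sqrt 3 * golden_pent * (golden - 1)) / 4)
                        ((sqrt 3 * golden - golden_pent * (golden - 1)) / 4)"
proof -
  have "2 * pi / 15 = pi / 3 - pi / 5" by simp
  then show ?thesis
    by (simp only: complex_eq_iff cis.simps complex.sel cos_diff sin_diff cos_60 sin_60 cos_sin_pi_5)
       (simp add: field_simps)
qed

lemma cis_pi_15:
  "cis (pi / 15) = Complex ((golden - 1 + sqrt 3 * golden_pent) / 4)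
                        ((golden_pent - sqrt 3 * (golden - 1)) / 4)"
proof -
  have e: "pi / 15 = 2 * (pi / 5) - pi / 3" by simp
  have "cos (2 * (pi / 5)) = (golden - 1) / 2"
    using golden_sq by (simp only: cos_double_cos cos_sin_pi_5) (simp add: field_simps)
  moreover have "sin (2 * (pi / 5)) = golden_pent / 2"
    using golden_sq by (simp only: sin_double cos_sin_pi_5) (simp add: field_simps power2_eq_square, algebra)
  ultimately show ?thesis
    by (simp only: complex_eq_iff cis.simps complex.sel e cos_diff sin_diff cos_60 sin_60)
       (simp add: field_simps)
qed

text \<open>The product of the reciprocal lengths of (golden, 1, 0) and (1, 1, 1), hence the common
  factor of the inner and cross products that make up the quaternion u w.\<close>

definition coxeter_k :: real where "coxeter_k = 1 / (sqrt 3 * golden_pent)"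

lemma coxeter_k: "coxeter_k * sqrt 3 * golden_pent = 1" "0 < coxeter_k"
  using golden_pent_sq by (simp_all add: coxeter_k_def)

lemma plane_x_eq: "plane_x = vector [1 + coxeter_k * golden\<^sup>2, - coxeter_k, coxeter_k * golden,
    - coxeter_k * (golden - 1)]"
  by (simp add: plane_x_def Let_def golden_pent_def[symmetric] coxeter_k_def[symmetric]
    inverse_golden[symmetric])

lemma plane_y_eq: "plane_y = vector [0, coxeter_k * sqrt 3 * golden + coxeter_k * golden_pent,
    coxeter_k * sqrt 3 + coxeter_k * golden_pent, coxeter_k * golden_pent]"
proof -
  have "1 / golden_pent = coxeter_k * sqrt 3" "1 / sqrt 3 = coxeter_k * golden_pent"
    using golden_pent_sq by (simp_all add: coxeter_k_def)
  then show ?thesis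
    by (simp add: plane_y_def Let_def golden_pent_def[symmetric])
qed

text \<open>The factors are exp (- pi u / 5) = (golden, -1, 1 - golden, 0) / 2 and exp (pi w / 3) =
  (1, 1, 1, 1) / 2, both vertices of the 600-cell; multiplying out leaves the single denominator 2.
  Their fifteenth powers are both -1, so the map has order 15 and not 30. On the plane u x = x w the
  two turns combine to x exp (2 pi w / 15).\<close>

definition rot24 :: "real ^ 4 \<Rightarrow> real ^ 4" where
  "rot24 x = vector
    [(golden * x $ 1 + (1 - golden) * x $ 2 - x $ 4) / 2,
     (x $ 2 + golden * x $ 3 + (1 - golden) * x $ 4) / 2,
     (x $ 1 + (golden - 1) * x $ 3 + golden * x $ 4) / 2,
     ((golden - 1) * x $ 1 + golden * x $ 2 - x $ 3) / 2]"

lemma linear_rot24: "linear rot24"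
  by (rule linearI)
     (simp_all add: vec_eq_iff forall_4 rot24_def vector_4 algebra_simps add_divide_distrib diff_divide_distrib)

text \<open>The form with a tail \<open>z\<close> catches a square that is followed by further
  factors.\<close>

lemma golden_reduce: "golden * golden = golden + 1" "golden * (golden * z) = golden * z + z"
  using golden_sq by (simp_all add: power2_eq_square algebra_simps flip: mult.assoc)

lemma pent_reduce: "golden_pent * golden_pent = golden + 2"
  "golden_pent * (golden_pent * z) = golden * z + 2 * z"
  using golden_pent_sq by (simp_all add: power2_eq_square algebra_simps flip: mult.assoc)

lemma sqrt_3_reduce: "sqrt 3 * (sqrt 3 * z) = 3 * z"
  by (simp flip: mult.assoc)

text \<open>Rationalised denominator: golden + 2 times its conjugate 3 - golden is 5. Everything
  then becomes polynomial in \<open>golden\<close>, \<open>sqrt 3\<close> and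
  \<open>golden_pent\<close>, and \<open>coxeter_reduce\<close> lowers the powers.\<close>

lemma coxeter_k_eq: "coxeter_k = sqrt 3 * golden_pent * (3 - golden) / 15"
proof -
  have "sqrt 3 * golden_pent * (sqrt 3 * golden_pent * (3 - golden) / 15) = 1"
    by (simp add: algebra_simps golden_reduce pent_reduce sqrt_3_reduce)
  then show ?thesis using golden_pent_sq unfolding coxeter_k_def by (simp add: field_simps)
qed

lemmas coxeter_reduce = golden_reduce pent_reduce sqrt_3_reduce coxeter_k_eq

lemma orthogonal_rot24: "orthogonal_transformation rot24"
proof -
  have "rot24 x \<bullet> rot24 y = x \<bullet> y" for x y
    unfolding inner_4 rot24_def vector_4 by (simp add: field_simps golden_reduce)
  then show ?thesis by (simp add: orthogonal_transformation_def linear_rot24)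
qed

definition plane_norm :: real where "plane_norm = norm plane_x"

text \<open>Both vectors have the length of 1 - u w, whose squared norm is 2 minus twice the real
  part of u w, and that real part is \<open>- coxeter_k * golden\<^sup>2\<close>. Equality of the
  lengths allows the common denominator in \<open>coxeter_proj_eq\<close>.\<close>

lemma plane_norms: "norm plane_x = plane_norm" "norm plane_y = plane_norm" "0 < plane_norm"
   "plane_norm\<^sup>2 = 2 * (1 + coxeter_k * golden\<^sup>2)"
proof -
  have x: "plane_x \<bullet> plane_x = 2 * (1 + coxeter_k * golden\<^sup>2)"
    unfolding plane_x_eq inner_4 vector_4 power2_eq_square by (simp add: field_simps coxeter_reduce)
  have "plane_y \<bullet> plane_y = 2 * (1 + coxeter_k * golden\<^sup>2)"
    unfolding plane_y_eq inner_4 vector_4 power2_eq_square by (simp add: field_simps coxeter_reduce)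
  with x show "norm plane_y = plane_norm" by (simp only: norm_eq_sqrt_inner plane_norm_def)
  show "plane_norm\<^sup>2 = 2 * (1 + coxeter_k * golden\<^sup>2)"
    by (simp only: x[symmetric] plane_norm_def power2_norm_eq_inner)
  then have "plane_norm\<^sup>2 > 0" using coxeter_k(2) golden_bounds by (simp add: add_pos_pos)
  then show "0 < plane_norm" by (simp add: plane_norm_def)
qed (simp add: plane_norm_def)

lemma coxeter_proj_eq: "coxeter_proj x = Complex (x \<bullet> plane_x) (x \<bullet> plane_y) / plane_norm"
  by (simp add: coxeter_proj_def plane_norms complex_eq_iff)

lemma coxeter_proj_rot24: "coxeter_proj (rot24 x) = cis (2 * pi / 15) * coxeter_proj x"
proof -
  have "rot24 x \<bullet> plane_x = (golden + sqrt 3 * golden_pent * (golden - 1)) / 4 * (x \<bullet> plane_x)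
        - (sqrt 3 * golden - golden_pent * (golden - 1)) / 4 * (x \<bullet> plane_y)"
    unfolding plane_x_eq plane_y_eq inner_4 vector_4 rot24_def power2_eq_square
    by (simp add: field_simps coxeter_reduce)
  moreover have "rot24 x \<bullet> plane_y = (golden + sqrt 3 * golden_pent * (golden - 1)) / 4 * (x \<bullet> plane_y)
        + (sqrt 3 * golden - golden_pent * (golden - 1)) / 4 * (x \<bullet> plane_x)"
    unfolding plane_x_eq plane_y_eq inner_4 vector_4 rot24_def power2_eq_square
    by (simp add: field_simps coxeter_reduce)
  ultimately show ?thesis
    unfolding coxeter_proj_eq cis_2pi_15 by (simp add: complex_eq_iff) 
qed

section \<open>Vertices over the golden integers\<close>

text \<open>The pair (a, b) stands for a + b golden, and a code for a point with twice the coordinates.\<close>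

type_synonym golden_int = "int \<times> int"

type_synonym code = "golden_int \<times> golden_int \<times> golden_int \<times> golden_int"

definition of_golden_int :: "golden_int \<Rightarrow> real" where
  "of_golden_int = (\<lambda>(a, b). of_int a + of_int b * golden)"

definition decode :: "code \<Rightarrow> real ^ 4" where
  "decode = (\<lambda>(x, y, z, w). vector
     [of_golden_int x / 2, of_golden_int y / 2, of_golden_int z / 2, of_golden_int w / 2])"

definition neg_code :: "code \<Rightarrow> code" where
  "neg_code = (\<lambda>((a, a'), (b, b'), (c, c'), (d, d')).
     ((- a, - a'), (- b, - b'), (- c, - c'), (- d, - d')))"

definition double_code :: "code \<Rightarrow> code" where
  "double_code = (\<lambda>((a, a'), (b, b'), (c, c'), (d, d')).
     ((2 * a, 2 * a'), (2 * b, 2 * b'), (2 * c, 2 * c'), (2 * d, 2 * d')))"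

text \<open>The matrix of \<open>rot24\<close> without its factor 1/2, multiplied out by the rule
  that the square of golden is golden + 1; it is exact on every code.\<close>

definition double_rot_code :: "code \<Rightarrow> code" where
  "double_rot_code = (\<lambda>((a, a'), (b, b'), (c, c'), (d, d')).
     ((a' + b - b' - d, a + a' - b - d'),
      (b + c' + d - d', b' + c + c' - d),
      (a - c + c' + d', a' + c + d + d'),
      (- a + a' + b' - c, a + b + b' - c')))"

text \<open>The division by 2 is exact on codes of vertices only.\<close>

definition rot_code :: "code \<Rightarrow> code" where
  "rot_code = (\<lambda>u. case double_rot_code u of ((a, a'), (b, b'), (c, c'), (d, d')) \<Rightarrow>
     ((a div 2, a' div 2), (b div 2, b' div 2), (c div 2, c' div 2), (d div 2, d' div 2)))"

text \<open>One vertex per ring, outermost first, chosen as the one with argument in [0, 12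
  degrees); \<open>start_cmod_less\<close> and \<open>start_Arg\<close> confirm the choice.\<close>

definition start_codes :: "code list" where
  "start_codes =
    [((2, 0), (0, 0), (0, 0), (0, 0)),
     ((0, 1), (-1, 1), (0, 0), (-1, 0)),
     ((1, 0), (-1, 0), (1, 0), (1, 0)),
     ((0, 0), (-1, 0), (0, 1), (1, -1))]"

text \<open>Evaluation obtains each iterate from its predecessor, unlike a list of powers
  \<open>f ^^ k\<close>.\<close>

primrec iterates :: "nat \<Rightarrow> ('a \<Rightarrow> 'a) \<Rightarrow> 'a \<Rightarrow> 'a list" where
  "iterates 0 f x = []"
| "iterates (Suc n) f x = x # iterates n f (f x)"

lemma iterates_eq: "iterates n f x = map (\<lambda>k. (f ^^ k) x) [0..<n]"
  by (induction n arbitrary: x) (simp_all add: upt_conv_Cons map_Suc_upt[symmetric] funpow_swap1 del: upt_Suc)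

text \<open>The order matters: counted from 0, entry n - 1 is the code of ray n, see
  \<open>map_ray_code\<close>.\<close>

definition ray_codes :: "code list" where
  "ray_codes = concat (map (iterates 15 rot_code) start_codes)"

definition even_arrangements :: "'a \<times> 'a \<times> 'a \<times> 'a \<Rightarrow> ('a \<times> 'a \<times> 'a \<times> 'a) list" where
  "even_arrangements = (\<lambda>(x, y, z, w).
     [(x, y, z, w), (x, z, w, y), (x, w, y, z), (y, x, w, z), (y, z, x, w), (y, w, z, x),
      (z, x, y, w), (z, y, w, x), (z, w, x, y), (w, x, z, y), (w, y, x, z), (w, z, y, x)])"

definition vertex_codes :: "code list" where
  "vertex_codes =
     concat (map (\<lambda>s. [((s, 0), (0, 0), (0, 0), (0, 0)), ((0, 0), (s, 0), (0, 0), (0, 0)),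
        ((0, 0), (0, 0), (s, 0), (0, 0)), ((0, 0), (0, 0), (0, 0), (s, 0))]) [2, - 2])
     @ concat (map (\<lambda>a. concat (map (\<lambda>b. concat (map (\<lambda>c.
         map (\<lambda>d. ((a, 0), (b, 0), (c, 0), (d, 0))) [1, - 1]) [1, - 1])) [1, - 1])) [1, - 1])
     @ concat (map (\<lambda>a. concat (map (\<lambda>b. concat (map (\<lambda>c.
         even_arrangements ((0, a), (b, 0), (- c, c), (0, 0))) [1, - 1])) [1, - 1])) [1, - 1])"

text \<open>Here the coordinate families of the definition meet the orbits of the rotation, as
  finite sets of integer tuples.\<close>

lemma set_vertex_codes: "set vertex_codes = set (ray_codes @ map neg_code ray_codes)"
  by code_simp

text \<open>The negatives are included so that no two of the 60 codes are antipodal; this separates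
  the rays later.\<close>

lemma distinct_ray_codes: "distinct (ray_codes @ map neg_code ray_codes)"
  by code_simp

lemma double_rot_ray_codes: "list_all (\<lambda>c. double_code (rot_code c) = double_rot_code c) ray_codes"
  by code_simp

section \<open>Even permutations of four coordinates and the three families of vertices\<close>

lemma UN_triple:
  "(\<Union>a\<in>A. \<Union>b\<in>B. \<Union>c\<in>C. {f a b c}) = (\<lambda>(a, b, c). f a b c) ` (A \<times> B \<times> C)"
  by force

text \<open>Every permutation is a product of three transpositions that settle the points 1, 2 and 3
  one after the other, where \<open>transpose i i\<close> is the identity; twelve of the 24 choices
  are even.\<close>

lemma even_permutations_4:
  "{\<sigma>. \<sigma> permutes (UNIV :: 4 set) \<and> evenperm \<sigma>} =
     (\<lambda>(a, b, c). Transposition.transpose 1 a \<circ> (Transposition.transpose 2 b \<circ> Transposition.transpose 3 c)) `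
       {(1,2,3), (1,3,4), (1,4,4), (2,2,4), (2,3,3), (2,4,3),
        (3,2,4), (3,3,3), (3,4,3), (4,2,4), (4,3,3), (4,4,3)}"
proof -
  have "{\<sigma>. \<sigma> permutes (UNIV :: 4 set)} =
     (\<lambda>(a, b, c). Transposition.transpose 1 a \<circ> (Transposition.transpose 2 b \<circ> Transposition.transpose 3 c)) `
        (UNIV \<times> {2, 3, 4} \<times> {3, 4})"
    (is "_ = ?R")
  proof -
    have e: "(UNIV :: 4 set) = insert 1 (insert 2 (insert 3 {4}))"
      by (auto simp: UNIV_4)
    have step: "{\<sigma>. \<sigma> permutes insert x S} =
        (\<Union>b\<in>insert x S. (\<circ>) (Transposition.transpose x b) ` {\<sigma>. \<sigma> permutes S})"
      for x :: 4 and S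
    proof -
      have "(\<lambda>(b, p). f b \<circ> p) ` {(b, p). b \<in> A \<and> p \<in> P} = (\<Union>b\<in>A. (\<circ>) (f b) ` P)"
        for f :: "4 \<Rightarrow> 4 \<Rightarrow> 4" and A and P :: "(4 \<Rightarrow> 4) set"
        by auto
      then show ?thesis unfolding permutes_insert .
    qed
    have "{\<sigma>. \<sigma> permutes (UNIV :: 4 set)} = (\<Union>a\<in>UNIV. \<Union>b\<in>{2, 3, 4}. \<Union>c\<in>{3, 4}.
       {Transposition.transpose 1 a \<circ> (Transposition.transpose 2 b \<circ> Transposition.transpose 3 c)})"
      unfolding e step[of 1 "{2, 3, 4}"] step[of 2 "{3, 4}"] step[of 3 "{4}"] permutes_sing
      by (simp only: image_insert image_empty Union_insert Union_empty image_Un Un_empty_right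
        Un_empty_left Un_insert_left Un_assoc singleton_conv comp_id)
    also have "\<dots> = ?R"
      unfolding UN_triple ..
    finally show ?thesis .
  qed
  \<comment> \<open>A nested equivalence of three truth values holds iff an even number of them are
    false, that is, iff an even number of the factors are genuine swaps.\<close>
  moreover have even: "evenperm (Transposition.transpose 1 a \<circ> (Transposition.transpose 2 b \<circ> Transposition.transpose 3 c)) \<longleftrightarrow>
      ((1 = a) = ((2 = b) = (3 = c)))" for a b c :: 4
    by (simp add: evenperm_comp evenperm_swap permutation_compose permutation_swap_id)
  moreover have filter: "{\<sigma>. P \<sigma>} = f ` A \<Longrightarrow> {\<sigma>. P \<sigma> \<and> Q \<sigma>} = f ` {x \<in> A. Q (f x)}"
    for P Q and f :: "4 \<times> 4 \<times> 4 \<Rightarrow> 4 \<Rightarrow> 4" and A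
    by auto
  ultimately have "{\<sigma>. \<sigma> permutes (UNIV :: 4 set) \<and> evenperm \<sigma>} =
     (\<lambda>(a, b, c). Transposition.transpose 1 a \<circ> (Transposition.transpose 2 b \<circ> Transposition.transpose 3 c)) `
        {(a, b, c) \<in> UNIV \<times> {2, 3, 4} \<times> {3, 4}. ((1 = a) = ((2 = b) = (3 = c)))}"
    by (simp only: filter split_def even mem_Collect_eq prod.collapse)
  also have "{(a, b, c) \<in> UNIV \<times> {2, 3, 4} \<times> {3, 4}. ((1 = a) = ((2 = b) = (3 = c)))} =
    {(1::4,2::4,3::4), (1,3,4), (1,4,4), (2,2,4), (2,3,3), (2,4,3),
        (3,2,4), (3,3,3), (3,4,3), (4,2,4), (4,3,3), (4,4,3)}"
    unfolding set_eq_iff split_paired_All forall_4 by simp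
  finally show ?thesis .
qed

lemma even_rearrangements_4:
  fixes x y z w :: real
  shows "{\<chi> i. vector [x, y, z, w] $ \<sigma> i | \<sigma>. \<sigma> permutes (UNIV :: 4 set) \<and> evenperm \<sigma>} =
   (\<lambda>(a, b, c, d). vector [a, b, c, d] :: real ^ 4) ` set (even_arrangements (x, y, z, w))"
proof -
  have "{\<chi> i. vector [x, y, z, w] $ \<sigma> i | \<sigma>. \<sigma> permutes (UNIV :: 4 set) \<and> evenperm \<sigma>} =
    (\<lambda>\<sigma>. (\<chi> i. vector [x, y, z, w] $ \<sigma> i) :: real ^ 4) ` {\<sigma>. \<sigma> permutes (UNIV :: 4 set) \<and> evenperm \<sigma>}"
    by auto
  \<comment> \<open>With the four coordinates listed explicitly, each of the twelve permutations can
    be evaluated by unfolding its transpositions.\<close>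
  also have "\<dots> = (\<lambda>\<sigma>. vector (map (\<lambda>i. (vector [x, y, z, w] :: real ^ 4) $ \<sigma> i) [1, 2, 3, 4])) `
      {\<sigma>. \<sigma> permutes (UNIV :: 4 set) \<and> evenperm \<sigma>}"
    by (intro image_cong) (simp_all add: vec_eq_iff forall_4 vector_4)
  also have "\<dots> = (\<lambda>(a, b, c, d). vector [a, b, c, d] :: real ^ 4) ` set (even_arrangements (x, y, z, w))"
    unfolding even_permutations_4 by (auto simp: even_arrangements_def vector_4 Transposition.transpose_def)
  finally show ?thesis .
qed

lemma decode_nth:
  "decode (x, y, z, w) $ 1 = of_golden_int x / 2" "decode (x, y, z, w) $ 2 = of_golden_int y / 2"
  "decode (x, y, z, w) $ 3 = of_golden_int z / 2" "decode (x, y, z, w) $ 4 = of_golden_int w / 2"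
  by (simp_all add: decode_def vector_4)

lemma axis_vertices:
  "{axis i s | i s. s \<in> {1, - 1}} =
     decode ` set (concat (map (\<lambda>s. [((s, 0), (0, 0), (0, 0), (0, 0)), ((0, 0), (s, 0), (0, 0), (0, 0)),
        ((0, 0), (0, 0), (s, 0), (0, 0)), ((0, 0), (0, 0), (0, 0), (s, 0))]) [2, - 2]))"
proof -
  have "{axis i s | i s. s \<in> {1, - 1}} = (\<Union>s\<in>{1, - 1}. (\<lambda>i. axis i s :: real ^ 4) ` UNIV)"
    by blast
  also have "\<dots> = {axis 1 1, axis 2 1, axis 3 1, axis 4 1, axis 1 (- 1), axis 2 (- 1), axis 3 (- 1), axis 4 (- 1)}"
    by (auto simp: UNIV_4)
  moreover have "axis 1 1 = decode ((2, 0), (0, 0), (0, 0), (0, 0))"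
      and "axis 2 1 = decode ((0, 0), (2, 0), (0, 0), (0, 0))"
      and "axis 3 1 = decode ((0, 0), (0, 0), (2, 0), (0, 0))"
      and "axis 4 1 = decode ((0, 0), (0, 0), (0, 0), (2, 0))"
      and "axis 1 (- 1) = decode ((- 2, 0), (0, 0), (0, 0), (0, 0))"
      and "axis 2 (- 1) = decode ((0, 0), (- 2, 0), (0, 0), (0, 0))"
      and "axis 3 (- 1) = decode ((0, 0), (0, 0), (- 2, 0), (0, 0))"
      and "axis 4 (- 1) = decode ((0, 0), (0, 0), (0, 0), (- 2, 0))"
    by (simp_all add: vec_eq_iff forall_4 decode_nth of_golden_int_def axis_def)
  ultimately show ?thesis by simp
qed

lemma half_vertices:
  "{v. \<forall>i. v $ i \<in> {1 / 2, - 1 / 2}} =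
     decode ` set (concat (map (\<lambda>a. concat (map (\<lambda>b. concat (map (\<lambda>c.
         map (\<lambda>d. ((a, 0), (b, 0), (c, 0), (d, 0))) [1, - 1]) [1, - 1])) [1, - 1])) [1, - 1]))"
proof -
  have half: "t \<in> {1 / 2, - 1 / 2} \<longleftrightarrow> (\<exists>a\<in>{1, - 1}. t = of_golden_int (a, 0) / 2)" for t :: real
    by (auto simp: of_golden_int_def)
  have "v \<in> {v. \<forall>i. v $ i \<in> {1 / 2, - 1 / 2}} \<longleftrightarrow>
     (\<exists>a\<in>{1, - 1}. \<exists>b\<in>{1, - 1}. \<exists>c\<in>{1, - 1}. \<exists>d\<in>{1, - 1}. v = decode ((a, 0), (b, 0), (c, 0), (d, 0)))" for v
    unfolding mem_Collect_eq half vec_eq_iff forall_4 decode_nth by blast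
  then have "{v. \<forall>i. v $ i \<in> {1 / 2, - 1 / 2}} =
     {v. (\<exists>a\<in>{1, - 1}. \<exists>b\<in>{1, - 1}. \<exists>c\<in>{1, - 1}. \<exists>d\<in>{1, - 1}. v = decode ((a, 0), (b, 0), (c, 0), (d, 0)))}"
    by blast
  also have "\<dots> = decode ` set (concat (map (\<lambda>a. concat (map (\<lambda>b. concat (map (\<lambda>c.
         map (\<lambda>d. ((a, 0), (b, 0), (c, 0), (d, 0))) [1, - 1]) [1, - 1])) [1, - 1])) [1, - 1]))"
    by auto
  finally show ?thesis .
qed

lemma golden_vertices:
  "{(\<chi> i. vector [s1 * golden / 2, s2 / 2, s3 / (2 * golden), 0] $ \<sigma> i) | \<sigma> s1 s2 s3.
        \<sigma> permutes (UNIV :: 4 set) \<and> evenperm \<sigma> \<and>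
        s1 \<in> {1, - 1} \<and> s2 \<in> {1, - 1} \<and> s3 \<in> {1, - 1}} =
   decode ` set (concat (map (\<lambda>a. concat (map (\<lambda>b. concat (map (\<lambda>c.
         even_arrangements ((0, a), (b, 0), (- c, c), (0, 0))) [1, - 1])) [1, - 1])) [1, - 1]))"
  (is "?L = ?R")
proof -
  have decode: "(\<lambda>(a, b, c, d). vector [a, b, c, d] :: real ^ 4) `
       set (even_arrangements (of_int a * golden / 2, of_int b / 2, of_int c / (2 * golden), 0)) =
     decode ` set (even_arrangements ((0, a), (b, 0), (- c, c), (0, 0)))" for a b c
  proof -
    \<comment> \<open>Since 1 / golden = golden - 1, dividing c by golden gives the pair (- c,
      c).\<close>
    have "of_int c / (2 * golden) = of_golden_int (- c, c) / 2"
    proof -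
      have "of_int c / (2 * golden) = of_int c * (1 / golden) / 2" by simp
      then show ?thesis unfolding inverse_golden by (simp add: of_golden_int_def algebra_simps)
    qed
    moreover have "of_int a * golden / 2 = of_golden_int (0, a) / 2"
      "of_int b / 2 = of_golden_int (b, 0) / 2" "0 = of_golden_int (0, 0) / 2"
      by (simp_all add: of_golden_int_def)
    ultimately show ?thesis
      by (simp only: even_arrangements_def decode_def split set_simps list.set image_insert image_empty)
  qed
  have split: "{F \<sigma> s1 s2 s3 | \<sigma> s1 s2 s3. P \<sigma> \<and> Q \<sigma> \<and> s1 \<in> S \<and> s2 \<in> S \<and> s3 \<in> S} =
      (\<Union>s1\<in>S. \<Union>s2\<in>S. \<Union>s3\<in>S. {F \<sigma> s1 s2 s3 | \<sigma>. P \<sigma> \<and> Q \<sigma>})"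
    for F :: "'a \<Rightarrow> real \<Rightarrow> real \<Rightarrow> real \<Rightarrow> real ^ 4" and P Q S
    by blast
  have "{1, - 1} = real_of_int ` {1, - 1}" by simp
  moreover have "(\<Union>s\<in>real_of_int ` A. B s) = (\<Union>a\<in>A. B (of_int a))" for A and B :: "real \<Rightarrow> (real ^ 4) set"
    by blast
  ultimately have "?L = (\<Union>a\<in>{1, - 1}. \<Union>b\<in>{1, - 1}. \<Union>c\<in>{1, - 1}.
    {\<chi> i. vector [of_int a * golden / 2, of_int b / 2, of_int c / (2 * golden), 0] $ \<sigma> i | \<sigma>.
       \<sigma> permutes (UNIV :: 4 set) \<and> evenperm \<sigma>})"
    by (simp only: split)
  also have "\<dots> = ?R"
    unfolding even_rearrangements_4 decode
    by (simp only: list.map concat.simps append_Nil2 set_append image_Un Un_assoc UN_insert UN_empty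
        Un_empty_right)
  finally show ?thesis .
qed

lemma vertices_eq_decode: "vertices = decode ` set (ray_codes @ map neg_code ray_codes)"
  unfolding set_vertex_codes[symmetric] vertices_def axis_vertices half_vertices golden_vertices
  unfolding vertex_codes_def set_append image_Un by (rule Un_assoc)

lemma decode_neg: "decode (neg_code c) = - decode c"
  by (simp add: neg_code_def split_def decode_def vec_eq_iff forall_4 vector_4
      of_golden_int_def field_simps)

lemma decode_rot:
  assumes "c \<in> set ray_codes"
  shows "decode (rot_code c) = rot24 (decode c)"
proof -
  have "double_code (rot_code c) = double_rot_code c"
    using assms double_rot_ray_codes by (simp add: list_all_iff)
  then have "decode (double_code (rot_code c)) = decode (double_rot_code c)" by simp
  moreover have "decode (double_code d) = 2 *\<^sub>R decode d" for d
    by (simp add: double_code_def split_def decode_def vec_eq_iff forall_4 vector_4 of_golden_int_def algebra_simps)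
  moreover have "decode (double_rot_code d) = 2 *\<^sub>R rot24 (decode d)" for d
    by (simp add: double_rot_code_def rot24_def split_def decode_def vec_eq_iff forall_4 vector_4
         of_golden_int_def field_simps golden_reduce)
  ultimately show ?thesis by simp
qed

section \<open>The rings of the projection\<close>

text \<open>Because \<open>rot24\<close> has order 15, the four orbits close up without a change of
  sign, so the 60 chosen representatives are permuted among themselves.\<close>

lemma rot_ray_codes: "set (map rot_code ray_codes) = set ray_codes"
  by code_simp

lemma rot24_uminus: "rot24 (- x) = - rot24 x"
  by (rule linear_neg[OF linear_rot24])

lemma rot24_vertices: "rot24 ` vertices = vertices"
proof -
  have "rot24 ` decode ` set ray_codes = decode ` rot_code ` set ray_codes"
    unfolding image_image by (intro image_cong refl) (simp add: decode_rot)
  also have "\<dots> = decode ` set ray_codes" using rot_ray_codes by simp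
  finally have "rot24 ` decode ` set ray_codes = decode ` set ray_codes" .
  moreover have neg: "rot24 ` uminus ` S = uminus ` rot24 ` S" for S
    by (simp add: image_image rot24_uminus)
  moreover have eq: "vertices = decode ` set ray_codes \<union> uminus ` decode ` set ray_codes"
    by (simp add: vertices_eq_decode image_Un image_image decode_neg)
  ultimately show ?thesis unfolding eq image_Un neg by simp
qed

lemma symmetry_rot24: "symmetry rot24"
  by (simp add: symmetry_def orthogonal_rot24 rot24_vertices)

lemma coxeter_proj_neg: "coxeter_proj (- x) = - coxeter_proj x"
  by (simp add: coxeter_proj_eq complex_eq_iff)

lemma coxeter_proj_rot24_funpow:
  "coxeter_proj ((rot24 ^^ k) x) = cis (2 * pi * real k / 15) * coxeter_proj x"
proof (induction k)
  case (Suc k)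
  have "2 * pi * real (Suc k) / 15 = 2 * pi / 15 + 2 * pi * real k / 15" by (simp add: field_simps)
  then have "cis (2 * pi * real (Suc k) / 15) = cis (2 * pi / 15) * cis (2 * pi * real k / 15)"
    by (simp only: cis_mult)
  then show ?case using Suc by (simp add: coxeter_proj_rot24)
qed simp

lemma funpow_rot_code_in:
  assumes "c \<in> set ray_codes" shows "(rot_code ^^ k) c \<in> set ray_codes"
  by (induction k) (use assms rot_ray_codes in auto)

lemma decode_rot_funpow:
  assumes "c \<in> set ray_codes"
  shows "decode ((rot_code ^^ k) c) = (rot24 ^^ k) (decode c)"
  by (induction k) (simp_all add: decode_rot funpow_rot_code_in[OF assms])

definition start_vec :: "nat \<Rightarrow> real ^ 4" where
  "start_vec q = decode (start_codes ! q)"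

lemma all_less_4: "(\<forall>q<4. P q) \<longleftrightarrow> P 0 \<and> P 1 \<and> P 2 \<and> P (3::nat)"
  by (auto simp: less_Suc_eq numeral_eq_Suc)

lemma set_ray_codes: "set ray_codes = (\<lambda>(q, k). (rot_code ^^ k) (start_codes ! q)) ` ({..<4} \<times> {..<15})"
proof -
  have "set ray_codes = (\<Union>c\<in>set start_codes. (\<lambda>k. (rot_code ^^ k) c) ` {..<15})"
    by (auto simp: ray_codes_def iterates_eq)
  also have "set start_codes = (!) start_codes ` {..<4}"
    by (simp add: lessThan_Suc numeral_eq_Suc start_codes_def insert_commute)
  finally show ?thesis by auto
qed

lemma start_code_in: "q < 4 \<Longrightarrow> start_codes ! q \<in> set ray_codes"
  unfolding set_ray_codes by (rule image_eqI[of _ _ "(q, 0)"]) auto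

lemma vertices_cases:
  assumes "v \<in> vertices"
  obtains e q k where "e \<in> {1, - 1}" "q < 4" "k < 15" "v = e *\<^sub>R (rot24 ^^ k) (start_vec q)"
proof -
  obtain c where c: "c \<in> set ray_codes" "v = decode c \<or> v = - decode c"
    using assms by (auto simp: vertices_eq_decode decode_neg)
  then obtain q k where qk: "q < 4" "k < 15" "c = (rot_code ^^ k) (start_codes ! q)"
    by (auto simp: set_ray_codes)
  then have "decode c = (rot24 ^^ k) (start_vec q)"
    by (simp add: decode_rot_funpow start_code_in start_vec_def)
  with c(2) qk that[of 1 q k] that[of "-1" q k] show ?thesis by auto
qed

lemma start_vec_nth:
  "start_vec 0 $ 1 = 1" "start_vec 0 $ 2 = 0" "start_vec 0 $ 3 = 0" "start_vec 0 $ 4 = 0"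
  "start_vec 1 $ 1 = golden / 2" "start_vec 1 $ 2 = (golden - 1) / 2"
  "start_vec 1 $ 3 = 0" "start_vec 1 $ 4 = - 1 / 2"
  "start_vec 2 $ 1 = 1 / 2" "start_vec 2 $ 2 = - 1 / 2" "start_vec 2 $ 3 = 1 / 2" "start_vec 2 $ 4 = 1 / 2"
  "start_vec 3 $ 1 = 0" "start_vec 3 $ 2 = - 1 / 2"
  "start_vec 3 $ 3 = golden / 2" "start_vec 3 $ 4 = (1 - golden) / 2"
  by (simp_all add: start_vec_def start_codes_def decode_nth of_golden_int_def)

lemma start_inner:
  "start_vec 0 \<bullet> plane_x = 1 + coxeter_k * (golden + 1)" "start_vec 0 \<bullet> plane_y = 0"
  "start_vec 1 \<bullet> plane_x = (golden + coxeter_k * (2 * golden + 1)) / 2"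
  "start_vec 1 \<bullet> plane_y = coxeter_k * (sqrt 3 - (2 - golden) * golden_pent) / 2"
  "start_vec 2 \<bullet> plane_x = (1 + coxeter_k * (golden + 3)) / 2"
  "start_vec 2 \<bullet> plane_y = coxeter_k * (golden_pent - sqrt 3 * (golden - 1)) / 2"
  "start_vec 3 \<bullet> plane_x = 2 * coxeter_k" "start_vec 3 \<bullet> plane_y = 0"
  unfolding inner_4 plane_x_eq plane_y_eq vector_4 power2_eq_square start_vec_nth
  by (simp_all add: algebra_simps add_divide_distrib diff_divide_distrib golden_reduce)

lemma cmod_coxeter_proj_sq:
  "(cmod (coxeter_proj x))\<^sup>2 = ((x \<bullet> plane_x)\<^sup>2 + (x \<bullet> plane_y)\<^sup>2) / plane_norm\<^sup>2"
  using plane_norms(3) by (simp add: coxeter_proj_eq norm_divide power_divide cmod_power2)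

lemma start_cmod_sq:
  "(cmod (coxeter_proj (start_vec 0)))\<^sup>2 = (1 + coxeter_k * (golden + 1)) / 2"
  "(cmod (coxeter_proj (start_vec 1)))\<^sup>2 = (1 + coxeter_k * (golden - 1)) / 2"
  "(cmod (coxeter_proj (start_vec 2)))\<^sup>2 = (1 - coxeter_k * (golden - 1)) / 2"
  "(cmod (coxeter_proj (start_vec 3)))\<^sup>2 = (1 - coxeter_k * (golden + 1)) / 2"
proof -
  have pos: "1 + coxeter_k * (golden + 1) > 0"
    using coxeter_k(2) golden_bounds by (intro add_pos_pos mult_pos_pos) auto
  \<comment> \<open>Each squared modulus before normalisation contains half of
    \<open>plane_norm\<^sup>2\<close> as a factor, which cancels.\<close>
  have step: "t / (2 * (1 + coxeter_k * golden\<^sup>2)) = s / 2"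
    if "t = (1 + coxeter_k * (golden + 1)) * s" for s t
    using pos unfolding that golden_sq by (simp add: nonzero_divide_eq_eq del: distrib_left_numeral)
  show "(cmod (coxeter_proj (start_vec 0)))\<^sup>2 = (1 + coxeter_k * (golden + 1)) / 2"
    "(cmod (coxeter_proj (start_vec 1)))\<^sup>2 = (1 + coxeter_k * (golden - 1)) / 2"
    "(cmod (coxeter_proj (start_vec 2)))\<^sup>2 = (1 - coxeter_k * (golden - 1)) / 2"
    "(cmod (coxeter_proj (start_vec 3)))\<^sup>2 = (1 - coxeter_k * (golden + 1)) / 2"
    unfolding cmod_coxeter_proj_sq plane_norms(4) start_inner
    by (rule step, simp add: power2_eq_square field_simps coxeter_reduce)+
qed

lemma start_cmod_less:
  "cmod (coxeter_proj (start_vec 3)) < cmod (coxeter_proj (start_vec 2))"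
  "cmod (coxeter_proj (start_vec 2)) < cmod (coxeter_proj (start_vec 1))"
  "cmod (coxeter_proj (start_vec 1)) < cmod (coxeter_proj (start_vec 0))"
proof -
  define a b where "a = coxeter_k * (golden - 1)" and "b = coxeter_k * (golden + 1)"
  have "0 < a" "a < b"
    using coxeter_k(2) golden_bounds by (auto simp: a_def b_def)
  then have
    "(cmod (coxeter_proj (start_vec 3)))\<^sup>2 < (cmod (coxeter_proj (start_vec 2)))\<^sup>2"
    "(cmod (coxeter_proj (start_vec 2)))\<^sup>2 < (cmod (coxeter_proj (start_vec 1)))\<^sup>2"
    "(cmod (coxeter_proj (start_vec 1)))\<^sup>2 < (cmod (coxeter_proj (start_vec 0)))\<^sup>2"
    unfolding start_cmod_sq a_def[symmetric] b_def[symmetric] by auto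
  then show
    "cmod (coxeter_proj (start_vec 3)) < cmod (coxeter_proj (start_vec 2))"
    "cmod (coxeter_proj (start_vec 2)) < cmod (coxeter_proj (start_vec 1))"
    "cmod (coxeter_proj (start_vec 1)) < cmod (coxeter_proj (start_vec 0))"
    by (auto dest: power_less_imp_less_base)
qed

lemma start_cmod_pos: "q < 4 \<Longrightarrow> 0 < cmod (coxeter_proj (start_vec q))"
proof -
  have "start_vec 3 \<bullet> plane_x \<noteq> 0" using coxeter_k(2) by (simp add: start_inner)
  then have "coxeter_proj (start_vec 3) \<noteq> 0"
    using plane_norms(3) by (simp add: coxeter_proj_eq complex_eq_iff)
  then have "0 < cmod (coxeter_proj (start_vec 3))" by simp
  then have "\<forall>q<4. 0 < cmod (coxeter_proj (start_vec q))"
    unfolding all_less_4 using start_cmod_less by linarith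
  then show "q < 4 \<Longrightarrow> 0 < cmod (coxeter_proj (start_vec q))" by blast
qed

lemma start_cmod_inj:
  assumes "q < 4" "r < 4" "cmod (coxeter_proj (start_vec q)) = cmod (coxeter_proj (start_vec r))"
  shows "q = r"
proof -
  have "\<forall>q<4. \<forall>r<4. cmod (coxeter_proj (start_vec q)) = cmod (coxeter_proj (start_vec r)) \<longrightarrow> q = r"
    unfolding all_less_4 using start_cmod_less by auto
  then show ?thesis using assms by blast
qed

lemma sign_cis_cancel:
  assumes "e \<in> {1, - 1}" "e' \<in> {1, - 1}" "k < 15" "k' < 15"
    and eq: "complex_of_real e * cis (2 * pi * real k / 15) = complex_of_real e' * cis (2 * pi * real k' / 15)"
  shows "e = e' \<and> k = k'"
proof -
  have "(cis (2 * pi * real k / 15)) ^ 15 = 1" for k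
  proof -
    have "(cis (2 * pi * real k / 15)) ^ 15 = cis (2 * pi * real k)"
      unfolding Complex.DeMoivre by (rule arg_cong[of _ _ cis]) simp
    then show ?thesis by (simp only: cis_multiple_2pi Ints_of_nat)
  qed
  \<comment> \<open>As 15 is odd, the fifteenth power removes the root of unity and keeps the
    sign.\<close>
  then have "complex_of_real e ^ 15 = complex_of_real e' ^ 15"
    using arg_cong[OF eq, of "\<lambda>z. z ^ 15"] by (simp add: power_mult_distrib)
  then have e: "e = e'" using assms by auto
  then have "cis (2 * pi * real k / real 15) = cis (2 * pi * real k' / real 15)"
    using eq assms by auto
  moreover have "inj_on (\<lambda>k. cis (2 * pi * real k / real 15)) {..<15}"
    using Complex.bij_betw_roots_unity[of 15] by (auto simp: bij_betw_def)
  ultimately show ?thesis using e assms by (auto simp: inj_on_def)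
qed

lemma coxeter_proj_scale_rot24:
  "coxeter_proj (e *\<^sub>R (rot24 ^^ k) x) = complex_of_real e * cis (2 * pi * real k / 15) * coxeter_proj x"
proof -
  have "coxeter_proj (e *\<^sub>R y) = complex_of_real e * coxeter_proj y" for y
    by (simp add: coxeter_proj_eq complex_eq_iff)
  then show ?thesis by (simp add: coxeter_proj_rot24_funpow)
qed

text \<open>The modulus determines the ring, the remaining factor determines sign and exponent.
  Every \<open>THE\<close> of the definitions is resolved through this.\<close>

lemma coxeter_proj_inj: "inj_on coxeter_proj vertices"
proof (rule inj_onI)
  fix v v' assume v: "v \<in> vertices" "v' \<in> vertices" "coxeter_proj v = coxeter_proj v'"
  obtain e q k where 1: "e \<in> {1, - 1}" "q < 4" "k < 15" "v = e *\<^sub>R (rot24 ^^ k) (start_vec q)"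
    using v(1) by (rule vertices_cases)
  obtain e' q' k' where 2: "e' \<in> {1, - 1}" "q' < 4" "k' < 15" "v' = e' *\<^sub>R (rot24 ^^ k') (start_vec q')"
    using v(2) by (rule vertices_cases)
  have eq: "complex_of_real e * cis (2 * pi * real k / 15) * coxeter_proj (start_vec q) =
     complex_of_real e' * cis (2 * pi * real k' / 15) * coxeter_proj (start_vec q')"
    using v(3) 1 2 by (simp only: coxeter_proj_scale_rot24)
  then have "cmod (complex_of_real e * cis (2 * pi * real k / 15) * coxeter_proj (start_vec q)) =
     cmod (complex_of_real e' * cis (2 * pi * real k' / 15) * coxeter_proj (start_vec q'))"
    by (rule arg_cong)
  then have "cmod (coxeter_proj (start_vec q)) = cmod (coxeter_proj (start_vec q'))"
    using 1(1) 2(1) by (auto simp: norm_mult)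
  then have q: "q = q'" using start_cmod_inj 1 2 by blast
  with eq start_cmod_pos[OF 1(2)] have
   "complex_of_real e * cis (2 * pi * real k / 15) = complex_of_real e' * cis (2 * pi * real k' / 15)"
    by simp
  from sign_cis_cancel[OF 1(1) 2(1) 1(3) 2(3) this] q 1(4) 2(4) show "v = v'" by simp
qed

lemma scale_rot24_vertices:
  assumes "e \<in> {1, - 1}" "q < 4"
  shows "e *\<^sub>R (rot24 ^^ k) (start_vec q) \<in> vertices"
proof -
  have "(rot24 ^^ k) (start_vec q) = decode ((rot_code ^^ k) (start_codes ! q))"
    using assms(2) by (simp add: decode_rot_funpow start_code_in start_vec_def)
  then show ?thesis
    using assms funpow_rot_code_in[OF start_code_in, of q k]
    by (auto simp: vertices_eq_decode image_Un image_image decode_neg)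
qed

lemma start_vec_vertices: "q < 4 \<Longrightarrow> start_vec q \<in> vertices"
  using scale_rot24_vertices[of 1 q 0] by simp

lemma cmod_coxeter_proj_vertices:
  "(\<lambda>v. cmod (coxeter_proj v)) ` vertices = (\<lambda>q. cmod (coxeter_proj (start_vec q))) ` {..<4}"
proof
  show "(\<lambda>v. cmod (coxeter_proj v)) ` vertices \<subseteq> (\<lambda>q. cmod (coxeter_proj (start_vec q))) ` {..<4}"
  proof
    fix r assume "r \<in> (\<lambda>v. cmod (coxeter_proj v)) ` vertices"
    then obtain v where "v \<in> vertices" "r = cmod (coxeter_proj v)" by blast
    then show "r \<in> (\<lambda>q. cmod (coxeter_proj (start_vec q))) ` {..<4}"
      by (elim vertices_cases) (auto simp: coxeter_proj_rot24_funpow norm_mult coxeter_proj_neg)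
  qed
qed (use start_vec_vertices in auto)

lemma circumradius_eq:
  assumes "q < 4"
  shows "circumradius q = cmod (coxeter_proj (start_vec q))"
proof -
  let ?r = "\<lambda>q. cmod (coxeter_proj (start_vec q))"
  have "?r ` {..<4} = set [?r 3, ?r 2, ?r 1, ?r 0]"
    by (simp add: lessThan_Suc numeral_eq_Suc)
  moreover have "sorted [?r 3, ?r 2, ?r 1, ?r 0]" "distinct [?r 3, ?r 2, ?r 1, ?r 0]"
    using start_cmod_less by auto
  ultimately have "sorted_list_of_set (?r ` {..<4}) = [?r 3, ?r 2, ?r 1, ?r 0]"
    by (simp only: sorted_list_of_set.idem_if_sorted_distinct)
  then have "\<forall>q<4. circumradius q = ?r q"
    unfolding all_less_4 circumradius_def cmod_coxeter_proj_vertices by simp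
  then show ?thesis using assms by blast
qed

text \<open>Conjugation followed by multiplication with \<open>cis a\<close> is the reflection in
  the line through 0 at angle a / 2. A fixed point lies on that line, and the open first quadrant
  excludes the opposite half-line.\<close>

lemma Arg_eq_half:
  assumes "0 < Re z" "0 < Im z" "z = cis a * cnj z" "0 < a" "a < pi"
  shows "Arg z = a / 2"
proof -
  have z: "z = rcis (cmod z) (Arg z)" by (simp add: rcis_cmod_Arg)
  have pos: "0 < cmod z" using assms(1) by auto
  have bounds: "0 < Arg z" "Arg z < pi / 2"
    using assms(1,2) Arg_Re_pos[of z] Arg_lt_pi[of z] by auto
  have "cis (Arg z) = cis a * cis (- Arg z)"
  proof -
    have "complex_of_real (cmod z) * cis (Arg z) = cis a * cnj (complex_of_real (cmod z) * cis (Arg z))"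
      using assms(3) z unfolding rcis_def by metis
    then show ?thesis using pos by (simp add: cis_cnj)
  qed
  then have "cis (2 * Arg z) = cis a"
    by (metis (no_types, lifting) cis_mult mult.assoc mult.right_neutral cis_zero add.left_inverse mult_2)
  then have "Arg (cis (2 * Arg z)) = Arg (cis a)" by simp
  then have "2 * Arg z = a"
    using bounds assms(4,5) by (simp add: Arg_cis)
  then show ?thesis by simp
qed

lemma start_coords:
  "0 < start_vec 0 \<bullet> plane_x" "0 < start_vec 1 \<bullet> plane_x" "0 < start_vec 2 \<bullet> plane_x" "0 < start_vec 3 \<bullet> plane_x"
  "0 < start_vec 1 \<bullet> plane_y" "0 < start_vec 2 \<bullet> plane_y"
proof -
  note pos = coxeter_k(2) golden_bounds golden_pent_sq(2)
  show "0 < start_vec 0 \<bullet> plane_x" "0 < start_vec 1 \<bullet> plane_x" "0 < start_vec 2 \<bullet> plane_x"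
     "0 < start_vec 3 \<bullet> plane_x"
    unfolding start_inner using pos by (simp_all add: add_pos_pos)
  \<comment> \<open>Signs are decided by comparing squares, which leaves only bounds on
    \<open>golden\<close>.\<close>
  have "((2 - golden) * golden_pent)\<^sup>2 = 7 - 4 * golden"
    by (simp add: power2_eq_square algebra_simps coxeter_reduce(1-4))
  then have "((2 - golden) * golden_pent)\<^sup>2 < (sqrt 3)\<^sup>2" using pos by simp
  then have "(2 - golden) * golden_pent < sqrt 3" by (rule power_less_imp_less_base) simp
  then show "0 < start_vec 1 \<bullet> plane_y" unfolding start_inner using pos by simp
  have "(sqrt 3 * (golden - 1))\<^sup>2 = 3 * (2 - golden)"
    by (simp add: power2_eq_square algebra_simps coxeter_reduce(1-5))
  then have "(sqrt 3 * (golden - 1))\<^sup>2 < golden_pent\<^sup>2" using pos golden_pent_sq(1) by simp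
  then have "sqrt 3 * (golden - 1) < golden_pent" using pos by (auto dest: power_less_imp_less_base)
  then show "0 < start_vec 2 \<bullet> plane_y" unfolding start_inner using pos by simp
qed

text \<open>Rings A and D start on the positive x-axis; B and C start at exactly 6 degrees, i.e. the start
  vertex is fixed by the reflection in the line at 6 degrees.\<close>

lemma start_Arg:
  assumes "q < 4"
  shows "0 \<le> Arg (coxeter_proj (start_vec q)) \<and> Arg (coxeter_proj (start_vec q)) < pi / 15"
proof -
  have real: "Arg (coxeter_proj x) = 0" if "0 < x \<bullet> plane_x" "x \<bullet> plane_y = 0" for x
    using that plane_norms(3) by (simp add: coxeter_proj_eq Arg_eq_0 complex_is_Real_iff)
  \<comment> \<open>The two coordinate equations are the reflection condition of
    \<open>Arg_eq_half\<close> with the value from \<open>cis_pi_15\<close> inserted.\<close>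
  have half: "Arg (coxeter_proj x) = pi / 15 / 2"
    if "0 < x \<bullet> plane_x" "0 < x \<bullet> plane_y"
      "x \<bullet> plane_x = (golden - 1 + sqrt 3 * golden_pent) / 4 * (x \<bullet> plane_x) +
         (golden_pent - sqrt 3 * (golden - 1)) / 4 * (x \<bullet> plane_y)"
      "x \<bullet> plane_y = (golden_pent - sqrt 3 * (golden - 1)) / 4 * (x \<bullet> plane_x) -
         (golden - 1 + sqrt 3 * golden_pent) / 4 * (x \<bullet> plane_y)" for x
  proof (rule Arg_eq_half)
    let ?z = "Complex (x \<bullet> plane_x) (x \<bullet> plane_y)"
    have "?z = cis (pi / 15) * cnj ?z"
      unfolding cis_pi_15 complex_eq_iff using that(3,4) by simp
    then show "coxeter_proj x = cis (pi / 15) * cnj (coxeter_proj x)"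
      unfolding coxeter_proj_eq by simp
  qed (use that plane_norms(3) in \<open>auto simp: coxeter_proj_eq\<close>)
  have "Arg (coxeter_proj (start_vec 1)) = pi / 15 / 2"
    by (rule half[OF start_coords(2) start_coords(5)]; unfold start_inner;
        simp add: algebra_simps add_divide_distrib diff_divide_distrib coxeter_reduce)
  moreover have "Arg (coxeter_proj (start_vec 2)) = pi / 15 / 2"
    by (rule half[OF start_coords(3) start_coords(6)]; unfold start_inner;
        simp add: algebra_simps add_divide_distrib diff_divide_distrib coxeter_reduce)
  moreover have "Arg (coxeter_proj (start_vec 0)) = 0" "Arg (coxeter_proj (start_vec 3)) = 0"
    using start_coords by (auto intro!: real simp: start_inner)
  ultimately have "\<forall>q<4. 0 \<le> Arg (coxeter_proj (start_vec q)) \<and> Arg (coxeter_proj (start_vec q)) < pi / 15"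
    unfolding all_less_4 using pi_gt_zero by (intro conjI; linarith)
  then show ?thesis using assms by blast
qed

text \<open>Two vertices of one ring differ by a 30th root of unity. Both arguments lie in an
  interval of length pi / 15 = 2 pi / 30 without its right end, so their difference, a multiple of
  that length, is 0.\<close>

lemma start_vertex_eq:
  assumes q: "q < 4"
  shows "start_vertex q = start_vec q"
  unfolding start_vertex_def circumradius_eq[OF q]
proof (rule the_equality)
  show "start_vec q \<in> vertices \<and> cmod (coxeter_proj (start_vec q)) = cmod (coxeter_proj (start_vec q)) \<and>
     0 \<le> Arg (coxeter_proj (start_vec q)) \<and> Arg (coxeter_proj (start_vec q)) < pi / 15"
    using start_vec_vertices start_Arg q by blast
  fix v assume v: "v \<in> vertices \<and> cmod (coxeter_proj v) = cmod (coxeter_proj (start_vec q)) \<and>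
     0 \<le> Arg (coxeter_proj v) \<and> Arg (coxeter_proj v) < pi / 15"
  obtain e r k where 1: "e \<in> {1, - 1}" "r < 4" "k < 15" "v = e *\<^sub>R (rot24 ^^ k) (start_vec r)"
    using v by (blast elim: vertices_cases)
  define u where "u = complex_of_real e * cis (2 * pi * real k / 15)"
  define z where "z = coxeter_proj (start_vec q)"
  have "cmod (coxeter_proj v) = cmod (coxeter_proj (start_vec r))"
    using 1 by (auto simp: coxeter_proj_scale_rot24 norm_mult coxeter_proj_neg coxeter_proj_rot24_funpow)
  then have "r = q" using v 1 q start_cmod_inj by auto
  then have pv: "coxeter_proj v = u * z"
    using 1 by (simp add: coxeter_proj_scale_rot24 u_def z_def)
  have z0: "z \<noteq> 0" using start_cmod_pos[OF q] by (auto simp: z_def)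
  have "u ^ 30 = 1"
  proof -
    have "u ^ 30 = (complex_of_real e ^ 30) * cis (2 * pi * real (2 * k))"
      unfolding u_def power_mult_distrib Complex.DeMoivre by (simp add: field_simps)
    also have "complex_of_real e ^ 30 = 1" using 1(1) by auto
    finally show ?thesis using cis_multiple_2pi[of "real (2 * k)"] by simp
  qed
  moreover have u: "u = cis (Arg (u * z) - Arg z)"
  proof -
    have "cmod (u * z) = cmod z" using v pv by (simp add: z_def)
    then have "rcis (cmod z) (Arg (u * z)) = u * rcis (cmod z) (Arg z)"
      using rcis_cmod_Arg[of "u * z"] rcis_cmod_Arg[of z] by simp
    then have "cis (Arg (u * z)) = u * cis (Arg z)" using z0 by (simp add: rcis_def)
    then show ?thesis by (simp add: cis_divide[symmetric])
  qed
  ultimately have "cis (30 * (Arg (u * z) - Arg z)) = 1"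
    using Complex.DeMoivre[of "Arg (u * z) - Arg z" 30] by simp
  then have "cos (30 * (Arg (u * z) - Arg z)) = 1" by (simp add: complex_eq_iff)
  then obtain m :: int where m: "30 * (Arg (u * z) - Arg z) = of_int m * 2 * pi"
    using cos_one_2pi_int[of "30 * (Arg (u * z) - Arg z)"] by blast
  have "\<bar>Arg (u * z) - Arg z\<bar> < pi / 15"
    using v start_Arg[OF q] unfolding pv z_def[symmetric] by linarith
  then have "30 * \<bar>Arg (u * z) - Arg z\<bar> < 30 * (pi / 15)"
    by (simp only: mult_less_cancel_left_pos zero_less_numeral)
  moreover have "30 * (pi / 15) = 2 * pi" by simp
  moreover have "30 * \<bar>Arg (u * z) - Arg z\<bar> = \<bar>of_int m * 2 * pi\<bar>"
    unfolding m[symmetric] by (simp only: abs_mult abs_numeral)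
  ultimately have "\<bar>of_int m * 2 * pi\<bar> < 2 * pi" by simp
  then have "\<bar>real_of_int m\<bar> < 1" by (simp add: abs_mult)
  then have "m = 0" by linarith
  then have "u = 1" using m u by simp
  then have "coxeter_proj v = coxeter_proj (start_vec q)" using pv by (simp add: z_def)
  then show "v = start_vec q"
    using coxeter_proj_inj v start_vec_vertices[OF q] by (auto simp: inj_on_def)
qed

section \<open>Rays and their numbering\<close>

definition ray_code :: "nat \<Rightarrow> code" where
  "ray_code n = (rot_code ^^ ((n - 1) mod 15)) (start_codes ! ((n - 1) div 15))"

lemma ring_less_4: "n \<in> {1..60} \<Longrightarrow> (n - 1) div 15 < (4 :: nat)"
  by auto

lemma ray_code_in: "n \<in> {1..60} \<Longrightarrow> ray_code n \<in> set ray_codes"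
  unfolding ray_code_def by (intro funpow_rot_code_in start_code_in ring_less_4)

lemma numbered_vertex_eq:
  assumes n: "n \<in> {1..60}"
  shows "numbered_vertex n = decode (ray_code n)"
proof -
  let ?q = "(n - 1) div 15" and ?k = "(n - 1) mod 15"
  note q = ring_less_4[OF n]
  have eq: "decode (ray_code n) = 1 *\<^sub>R (rot24 ^^ ?k) (start_vec ?q)"
    using q by (simp add: ray_code_def decode_rot_funpow start_code_in start_vec_def)
  have in_vertices: "decode (ray_code n) \<in> vertices"
    unfolding eq by (rule scale_rot24_vertices[OF _ q]) simp
  have proj: "coxeter_proj (decode (ray_code n)) = cis (2 * pi * real ?k / 15) * coxeter_proj (start_vertex ?q)"
    unfolding eq coxeter_proj_scale_rot24 start_vertex_eq[OF q] by simp
  show ?thesis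
    unfolding numbered_vertex_def proj[symmetric]
    using in_vertices coxeter_proj_inj by (intro the_equality) (auto simp: inj_on_def)
qed

lemma numbers_upt: "{1..60} = set [1..<61::nat]"
  by auto

lemma map_ray_code: "map ray_code [1..<61] = ray_codes"
  by code_simp

lemma ray_code_next:
  assumes "n \<in> {1..60}"
  shows "ray_code (next_number n) = rot_code (ray_code n)"
proof -
  have "list_all (\<lambda>n. ray_code (next_number n) = rot_code (ray_code n)) [1..<61]"
    by code_simp
  then show ?thesis using assms unfolding numbers_upt list_all_iff by blast
qed

lemma next_number_in: "n \<in> {1..60} \<Longrightarrow> next_number n \<in> {1..60}"
  unfolding next_number_def by (simp, presburger)

lemma vertices_eq: "vertices = (\<lambda>n. decode (ray_code n)) ` {1..60} \<union> (\<lambda>n. - decode (ray_code n)) ` {1..60}"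
  unfolding vertices_eq_decode set_append set_map map_ray_code[symmetric] image_Un image_image
    numbers_upt decode_neg ..

lemma of_golden_int_inj: "inj of_golden_int"
proof (rule injI, clarify)
  fix a b c d assume "of_golden_int (a, b) = of_golden_int (c, d)"
  then have "of_int (a - c) + of_int (b - d) * golden = 0"
    by (simp add: of_golden_int_def algebra_simps)
  then have "a - c = 0 \<and> b - d = 0" by (rule golden_int_combination_0)
  then show "a = c \<and> b = d" by simp
qed

lemma decode_inj: "inj decode"
proof (rule injI)
  fix c d assume "decode c = decode d"
  then show "c = d"
    by (cases c; cases d) (simp add: vec_eq_iff forall_4 decode_nth inj_eq[OF of_golden_int_inj])
qed

lemma ray_code_neq_neg: "m \<in> {1..60} \<Longrightarrow> n \<in> {1..60} \<Longrightarrow> ray_code m \<noteq> neg_code (ray_code n)"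
  using distinct_ray_codes ray_code_in by (fastforce simp: distinct_append)

lemma ray_code_inj: "inj_on ray_code {1..60}"
  using distinct_ray_codes unfolding map_ray_code[symmetric] numbers_upt distinct_append distinct_map
  by blast

lemma norm_vertices: "v \<in> vertices \<Longrightarrow> norm v = 1"
proof -
  have "norm ((rot24 ^^ k) x) = norm x" for k x
    by (induction k) (simp_all add: orthogonal_transformation_norm[OF orthogonal_rot24])
  moreover have "\<forall>q<4. norm (start_vec q) = 1"
    unfolding all_less_4 norm_eq_sqrt_inner inner_4 start_vec_nth
    by (simp add: field_simps golden_reduce)
  ultimately show "v \<in> vertices \<Longrightarrow> norm v = 1"
    by (elim vertices_cases) auto
qed

lemma decode_ray_code_vertices: "n \<in> {1..60} \<Longrightarrow> decode (ray_code n) \<in> vertices"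
  by (auto simp: vertices_eq)

lemma ray_eq: "n \<in> {1..60} \<Longrightarrow> ray n = span {decode (ray_code n)}"
  by (simp add: ray_def numbered_vertex_eq)

lemma rays_eq: "rays = ray ` {1..60}"
proof -
  have neg: "span {- v} = span {v}" for v :: "real ^ 4"
    by (auto simp: span_singleton image_iff) (metis add.inverse_inverse scaleR_minus_left)+
  have "rays = (\<lambda>v. span {v}) ` vertices" by (auto simp: rays_def)
  also have "\<dots> = (\<lambda>n. span {decode (ray_code n)}) ` {1..60}"
    unfolding vertices_eq image_Un image_image neg by simp
  also have "\<dots> = ray ` {1..60}" using ray_eq by (intro image_cong) auto
  finally show ?thesis .
qed

text \<open>Unit vectors spanning the same line are equal or opposite. By
  \<open>distinct_ray_codes\<close> the first forces m = n and the second never happens.\<close>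

lemma ray_inj: "inj_on ray {1..60}"
proof (rule inj_onI)
  fix m n :: nat assume mn: "m \<in> {1..60}" "n \<in> {1..60}" "ray m = ray n"
  let ?v = "decode (ray_code m)" and ?w = "decode (ray_code n)"
  have "?v \<in> span {?w}" using mn by (metis ray_eq span_base singletonI)
  then obtain c where c: "?v = c *\<^sub>R ?w" by (auto simp: span_singleton)
  moreover have "norm ?v = 1" "norm ?w = 1" using mn norm_vertices decode_ray_code_vertices by blast+
  ultimately have "\<bar>c\<bar> = 1" by simp
  then have "?v = ?w \<or> ?v = - ?w" using c by (auto simp: abs_eq_iff')
  then have "ray_code m = ray_code n \<or> ray_code m = neg_code (ray_code n)"
    using decode_inj by (metis decode_neg injD)
  then show "m = n" using mn ray_code_neq_neg ray_code_inj by (auto simp: inj_on_def)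
qed

lemma rot24_ray:
  assumes "n \<in> {1..60}"
  shows "rot24 ` ray n = ray (next_number n)"
  using assms next_number_in[OF assms]
  by (simp add: ray_eq ray_code_next decode_rot ray_code_in linear_span_image[OF linear_rot24, symmetric])

text \<open>A competitor maps vertices to vertices and projects like \<open>rot24\<close>, so the
  two agree on vertices by injectivity of the projection. The standard basis vectors are vertices,
  and both maps are linear.\<close>

lemma g_eq: "g = rot24"
  unfolding g_def
proof (rule the_equality)
  show "symmetry rot24 \<and> (\<forall>x. coxeter_proj (rot24 x) = cis (2 * pi / 15) * coxeter_proj x)"
    using symmetry_rot24 coxeter_proj_rot24 by blast
  fix f assume f: "symmetry f \<and> (\<forall>x. coxeter_proj (f x) = cis (2 * pi / 15) * coxeter_proj x)"
  have "f v = rot24 v" if "v \<in> vertices" for v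
  proof -
    have "f v \<in> vertices" "rot24 v \<in> vertices"
      using f symmetry_rot24 that by (auto simp: symmetry_def)
    moreover have "coxeter_proj (f v) = coxeter_proj (rot24 v)" using f coxeter_proj_rot24 by simp
    ultimately show ?thesis using coxeter_proj_inj by (auto simp: inj_on_def)
  qed
  moreover have "axis i 1 \<in> vertices" for i by (auto simp: vertices_def)
  moreover have "linear f" using f by (simp add: symmetry_def orthogonal_transformation_def)
  ultimately show "f = rot24"
    using linear_rot24 by (intro linear_eq_stdbasis) (auto simp: Basis_vec_def)
qed

section \<open>Orthogonality of rays in integer arithmetic\<close>

definition inner_code :: "code \<Rightarrow> code \<Rightarrow> golden_int" where
  "inner_code = (\<lambda>((a, a'), (b, b'), (c, c'), (d, d')) ((e, e'), (f, f'), (g, g'), (h, h')).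
     (a * e + a' * e' + b * f + b' * f' + c * g + c' * g' + d * h + d' * h',
      a * e' + a' * e + a' * e' + b * f' + b' * f + b' * f' +
      c * g' + c' * g + c' * g' + d * h' + d' * h + d' * h'))"

text \<open>Codes hold doubled coordinates, hence the 4.\<close>

lemma inner_decode: "decode c \<bullet> decode d = of_golden_int (inner_code c d) / 4"
  by (cases c; cases d; clarify)
     (simp add: inner_4 decode_nth inner_code_def of_golden_int_def field_simps golden_reduce)

lemma orthogonal_rays_iff:
  assumes "m \<in> {1..60}" "n \<in> {1..60}"
  shows "orthogonal_rays (ray m) (ray n) \<longleftrightarrow> inner_code (ray_code m) (ray_code n) = (0, 0)"
proof -
  have "orthogonal_rays (span {v}) (span {w}) \<longleftrightarrow> v \<bullet> w = 0" for v w
    by (auto simp: orthogonal_rays_def span_singleton orthogonal_def)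
  moreover have "of_golden_int x = 0 \<longleftrightarrow> x = (0, 0)" for x
    using golden_int_combination_0 by (auto simp: of_golden_int_def split: prod.splits)
  ultimately show ?thesis using assms by (simp add: ray_eq inner_decode)
qed

section \<open>Bases\<close>

text \<open>Only later neighbours of \<open>x\<close> are kept, so a clique appears as a sublist in
  the order of the input; on ascending numbers the results are ascending.\<close>

fun cliques :: "('a \<Rightarrow> 'a \<Rightarrow> bool) \<Rightarrow> nat \<Rightarrow> 'a list \<Rightarrow> 'a list list" where
  "cliques E 0 xs = [[]]"
| "cliques E (Suc k) [] = []"
| "cliques E (Suc k) (x # xs) = map ((#) x) (cliques E k (filter (E x) xs)) @ cliques E (Suc k) xs"

lemma cliques_sound:
  assumes "symp E" "distinct xs" "c \<in> set (cliques E k xs)"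
  shows "distinct c \<and> length c = k \<and> set c \<subseteq> set xs \<and> pairwise E (set c)"
  using assms
proof (induction E k xs arbitrary: c rule: cliques.induct)
  case (3 E k x xs)
  from 3(5) consider d where "c = x # d" "d \<in> set (cliques E k (filter (E x) xs))"
    | "c \<in> set (cliques E (Suc k) xs)" by auto
  then show ?case
  proof cases
    case 1
    have "distinct d \<and> length d = k \<and> set d \<subseteq> set (filter (E x) xs) \<and> pairwise E (set d)"
      using 3(1)[OF 3(3) _ 1(2)] 3(4) by simp
    moreover from this have "\<forall>y\<in>set d. E x y \<and> E y x \<and> y \<in> set xs"
      using sympD[OF 3(3)] by auto
    ultimately show ?thesis using 1(1) 3(4) by (auto simp: pairwise_insert)
  next
    case 2
    then show ?thesis using 3(2)[OF 3(3) _ 2] 3(4) by auto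
  qed
qed auto

lemma cliques_complete:
  assumes "symp E" "B \<subseteq> set xs" "card B = k" "pairwise E B"
  shows "\<exists>c\<in>set (cliques E k xs). set c = B"
  using assms
proof (induction E k xs arbitrary: B rule: cliques.induct)
  case (1 E xs)
  then have "finite B" by (meson List.finite_set finite_subset)
  with 1 show ?case by simp
next
  case (3 E k x xs)
  then have fin: "finite B" by (meson List.finite_set finite_subset)
  show ?case
  proof (cases "x \<in> B")
    case True
    have "B - {x} \<subseteq> set (filter (E x) xs)"
      using 3 True by (auto simp: pairwise_def)
    moreover have "card (B - {x}) = k" using True fin 3 by simp
    moreover have "pairwise E (B - {x})" using 3 by (auto simp: pairwise_def)
    ultimately obtain c where "c \<in> set (cliques E k (filter (E x) xs))" "set c = B - {x}"
      using 3(1) 3(3) by blast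
    then have "x # c \<in> set (cliques E (Suc k) (x # xs))" "set (x # c) = B" using True by auto
    then show ?thesis by blast
  next
    case False
    then have "B \<subseteq> set xs" using 3 by auto
    then obtain c where "c \<in> set (cliques E (Suc k) xs)" "set c = B" using 3 by blast
    then show ?thesis by auto
  qed
qed simp

definition generator_list :: "letter \<Rightarrow> nat list" where
  "generator_list l = (case l of La \<Rightarrow> [1, 5, 55, 56] | Lb \<Rightarrow> [16, 18, 36, 43] | Lc \<Rightarrow> [1, 19, 43, 49]
     | Ld \<Rightarrow> [1, 20, 41, 58] | Le \<Rightarrow> [1, 27, 42, 46])"

definition letters :: "letter list" where
  "letters = [La, Lb, Lc, Ld, Le]"

lemma set_letters: "set letters = UNIV"
proof -
  have "l \<in> set letters" for l by (cases l) (simp_all add: letters_def)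
  then show ?thesis by blast
qed

definition orbit_lists :: "letter \<Rightarrow> nat list list" where
  "orbit_lists l = iterates 15 (map next_number) (generator_list l)"

definition basis_lists :: "nat list list" where
  "basis_lists = concat (map orbit_lists letters)"

text \<open>Pairing each code with its number lets the search run on finished codes while the
  cliques found can still be named by numbers.\<close>

definition orthogonal_codes :: "nat \<times> code \<Rightarrow> nat \<times> code \<Rightarrow> bool" where
  "orthogonal_codes = (\<lambda>(m, c) (n, d). inner_code c d = (0, 0))"

text \<open>The exhaustive search showing that the five orbits contain all bases. Cliques come out
  ascending, so sorting the listed bases makes the two sides comparable.\<close>

lemma cliques_eq_basis_lists:
  "set (map (map fst) (cliques orthogonal_codes 4 (zip [1..<61] ray_codes))) = set (map sort basis_lists)"
  by code_simp

text \<open>This gives 75 different bases: the five orbits are disjoint and each has full length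
  15.\<close>

lemma distinct_basis_lists: "distinct (map sort basis_lists) \<and> list_all distinct basis_lists"
  by code_simp

section \<open>Shifting ray numbers as addition modulo 15\<close>

lemma next_number_ring:
  assumes "n \<in> {1..60}"
  shows "(next_number n - 1) div 15 = (n - 1) div 15"
    "(next_number n - 1) mod 15 = ((n - 1) mod 15 + 1) mod 15"
proof -
  have "list_all (\<lambda>n. (next_number n - 1) div 15 = (n - 1) div 15 \<and>
      (next_number n - 1) mod 15 = ((n - 1) mod 15 + 1) mod 15) [1..<61]"
    by code_simp
  then show "(next_number n - 1) div 15 = (n - 1) div 15"
    "(next_number n - 1) mod 15 = ((n - 1) mod 15 + 1) mod 15"
    using assms unfolding numbers_upt list_all_iff by blast+
qed

lemma mod_add_less_double: "(a + b) mod c = (if a + b < c then a + b else a + b - c)"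
  if "a < c" "b < c" for a b c :: nat
  using that by (simp add: le_mod_geq)

lemma mod_add_diff: "(b + c - a) mod c = (if a \<le> b then b - a else b + c - a)"
  if "a < c" "b < c" for a b c :: nat
  using that by (simp add: le_mod_geq)

text \<open>Adding \<open>c\<close> before subtracting \<open>a\<close> keeps the difference of
  natural numbers from being cut off at 0.\<close>

lemma add_mod_eq_iff:
  assumes "a < c" "b < c" "k < c"
  shows "(a + k) mod c = b \<longleftrightarrow> k = (b + c - a) mod (c :: nat)"
  using assms mod_add_less_double[of a c k] mod_add_diff[of a c b] by auto

lemma funpow_next_number:
  assumes "n \<in> {1..60}"
  shows "(next_number ^^ k) n \<in> {1..60}"
    and "((next_number ^^ k) n - 1) div 15 = (n - 1) div 15"
    and "((next_number ^^ k) n - 1) mod 15 = ((n - 1) mod 15 + k) mod 15"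
proof (induction k)
  case (Suc k)
  { case 1 show ?case using next_number_in Suc(1) by simp }
  { case 2 show ?case using next_number_ring(1)[OF Suc(1)] Suc(2) by simp }
  { case 3 show ?case
      by (simp only: funpow.simps comp_apply next_number_ring(2)[OF Suc(1)] Suc(3)) (simp add: mod_Suc_eq) }
qed (use assms in auto)

lemma number_eqI:
  assumes "m \<in> {1..60}" "n \<in> {1..60}" "(m - 1) div 15 = (n - 1) div 15"
    "(m - 1) mod 15 = (n - 1) mod (15::nat)"
  shows "m = n"
proof -
  have "m - 1 = n - 1" using assms(3,4) by (metis div_mult_mod_eq)
  then show ?thesis using assms(1,2) by auto
qed

text \<open>The shift acts on each ring as the successor modulo 15 does, so exactly one shift below
  15 joins two numbers of the same ring.\<close>

lemma funpow_next_number_eq_iff: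
  assumes "m \<in> {1..60}" "n \<in> {1..60}" "k < 15"
  shows "(next_number ^^ k) m = n \<longleftrightarrow>
    (m - 1) div 15 = (n - 1) div 15 \<and> k = ((n - 1) mod 15 + 15 - (m - 1) mod 15) mod 15"
proof -
  have "((m - 1) mod 15 + k) mod 15 = (n - 1) mod 15 \<longleftrightarrow> k = ((n - 1) mod 15 + 15 - (m - 1) mod 15) mod 15"
    using assms(3) by (intro add_mod_eq_iff) simp_all
  moreover have "(next_number ^^ k) m = n \<longleftrightarrow>
      (m - 1) div 15 = (n - 1) div 15 \<and> ((m - 1) mod 15 + k) mod 15 = (n - 1) mod 15"
    using funpow_next_number[OF assms(1), of k] number_eqI[OF _ assms(2), of "(next_number ^^ k) m"]
    by metis
  ultimately show ?thesis by simp
qed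

definition basis_numbers :: "letter \<times> nat \<Rightarrow> nat set" where
  "basis_numbers = (\<lambda>(l, k). (next_number ^^ k) ` generator l)"

lemma generator_subset: "generator l \<subseteq> {1..60}"
  by (cases l) auto

lemma basis_numbers_subset: "basis_numbers x \<subseteq> {1..60}"
  using funpow_next_number(1) generator_subset by (cases x) (force simp: basis_numbers_def)

lemma generator_eq_list: "generator l = set (generator_list l)"
  by (cases l) (auto simp: generator_list_def)

definition index_set :: "(letter \<times> nat) set" where
  "index_set = UNIV \<times> {..<15}"

definition basis_list :: "letter \<times> nat \<Rightarrow> nat list" where
  "basis_list = (\<lambda>(l, k). map (next_number ^^ k) (generator_list l))"

lemma set_basis_list: "set (basis_list x) = basis_numbers x"
  by (cases x) (simp add: basis_list_def basis_numbers_def generator_eq_list)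

lemma map_funpow: "(map f ^^ k) xs = map (f ^^ k) xs" for f :: "'a \<Rightarrow> 'a"
  by (induction k) simp_all

lemma basis_lists_eq: "basis_lists = map basis_list (List.product letters [0..<15])"
proof -
  have "orbit_lists = (\<lambda>l. map (\<lambda>k. basis_list (l, k)) [0..<15])"
    by (rule ext) (simp add: orbit_lists_def iterates_eq basis_list_def map_funpow)
  then show ?thesis
    by (simp add: basis_lists_def product_concat_map map_concat comp_def)
qed

lemma index_set_eq: "index_set = set (List.product letters [0..<15])"
  by (simp add: index_set_def set_letters atLeast0LessThan)

lemma set_basis_lists: "set basis_lists = basis_list ` index_set"
  by (simp add: basis_lists_eq index_set_eq)

lemma distinct_basis_list: "x \<in> index_set \<Longrightarrow> distinct (basis_list x)"
  using distinct_basis_lists set_basis_lists by (auto simp: list_all_iff)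

lemma basis_numbers_inj: "inj_on basis_numbers index_set"
proof (rule inj_onI)
  fix x y assume xy: "x \<in> index_set" "y \<in> index_set" "basis_numbers x = basis_numbers y"
  then have "sort (basis_list x) = sort (basis_list y)"
    by (intro sorted_distinct_set_unique) (simp_all add: distinct_basis_list set_basis_list)
  moreover have "inj_on (\<lambda>x. sort (basis_list x)) index_set"
    using distinct_basis_lists unfolding basis_lists_eq index_set_eq by (simp add: distinct_map comp_def)
  ultimately show "x = y" using xy by (auto simp: inj_on_def)
qed

definition basis :: "letter \<times> nat \<Rightarrow> ray set" where
  "basis x = ray ` basis_numbers x"

lemma basis_inj: "inj_on basis index_set"
  using basis_numbers_inj ray_inj basis_numbers_subset unfolding basis_def
  by (meson inj_onI inj_onD inj_on_image_eq_iff)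

lemma ray_in_basis: "n \<in> {1..60} \<Longrightarrow> ray n \<in> basis x \<longleftrightarrow> n \<in> basis_numbers x"
  using ray_inj basis_numbers_subset unfolding basis_def by (meson inj_on_image_mem_iff)

lemma symp_orthogonal_codes: "symp orthogonal_codes"
  by (auto simp: symp_def orthogonal_codes_def inner_code_def algebra_simps)

lemma set_numbered_codes: "set (zip [1..<61] ray_codes) = (\<lambda>n. (n, ray_code n)) ` {1..60}"
  unfolding map_ray_code[symmetric] numbers_upt by (simp add: zip_map2 zip_same_conv_map)

lemma pairwise_orthogonal_codes:
  assumes "N \<subseteq> {1..60}"
  shows "pairwise orthogonal_codes ((\<lambda>n. (n, ray_code n)) ` N) \<longleftrightarrow> pairwise orthogonal_rays (ray ` N)"
proof -
  have "orthogonal_rays (ray m) (ray n) \<longleftrightarrow> orthogonal_codes (m, ray_code m) (n, ray_code n)"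
    if "m \<in> N" "n \<in> N" for m n
    using that assms by (subst orthogonal_rays_iff) (auto simp: orthogonal_codes_def)
  moreover have "ray m = ray n \<longleftrightarrow> m = n" if "m \<in> N" "n \<in> N" for m n
    using that assms ray_inj by (meson inj_on_eq_iff subsetD)
  ultimately show ?thesis by (auto simp: pairwise_def)
qed

text \<open>Bases correspond to 4-cliques of numbered codes; completeness of the search gives the
  first inclusion, soundness the second.\<close>

lemma bases_eq: "bases = basis ` index_set"
proof
  show "bases \<subseteq> basis ` index_set"
  proof
    fix B assume "B \<in> bases"
    then have B: "B \<subseteq> ray ` {1..60}" "card B = 4" "pairwise orthogonal_rays B"
      by (auto simp: bases_def rays_eq)
    then obtain N where N: "N \<subseteq> {1..60}" "B = ray ` N" by (auto simp: subset_image_iff)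
    let ?P = "(\<lambda>n. (n, ray_code n)) ` N"
    have "card N = 4" using B N ray_inj by (metis card_image inj_on_subset)
    then have "card ?P = 4" by (subst card_image) (auto intro: inj_onI)
    moreover have "?P \<subseteq> set (zip [1..<61] ray_codes)" using N unfolding set_numbered_codes by blast
    moreover have "pairwise orthogonal_codes ?P" using B N pairwise_orthogonal_codes by blast
    ultimately obtain c where c: "c \<in> set (cliques orthogonal_codes 4 (zip [1..<61] ray_codes))" "set c = ?P"
      using cliques_complete[OF symp_orthogonal_codes] by blast
    then have "map fst c \<in> set (map sort basis_lists)"
      unfolding cliques_eq_basis_lists[symmetric] by simp
    then obtain x where x: "x \<in> index_set" "map fst c = sort (basis_list x)"
      by (auto simp: set_basis_lists)
    have "N = fst ` set c" unfolding c by (simp add: image_image)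
    also have "\<dots> = basis_numbers x" using x(2) by (metis list.set_map set_sort set_basis_list)
    finally show "B \<in> basis ` index_set" using x(1) N by (auto simp: basis_def)
  qed
  show "basis ` index_set \<subseteq> bases"
  proof
    fix B assume "B \<in> basis ` index_set"
    then obtain x where x: "x \<in> index_set" "B = basis x" by blast
    then have "sort (basis_list x) \<in> set (map sort basis_lists)" by (auto simp: set_basis_lists)
    then obtain c where c: "c \<in> set (cliques orthogonal_codes 4 (zip [1..<61] ray_codes))"
       "sort (basis_list x) = map fst c"
      unfolding cliques_eq_basis_lists[symmetric] by auto
    have "distinct (zip [1..<61] ray_codes)" by (simp add: distinct_zipI1)
    note s = cliques_sound[OF symp_orthogonal_codes this c(1)]
    have N: "basis_numbers x = fst ` set c" using c(2) by (metis list.set_map set_sort set_basis_list)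
    have "set c = (\<lambda>n. (n, ray_code n)) ` basis_numbers x"
      using s unfolding N set_numbered_codes by (force simp: image_iff)
    then have "pairwise orthogonal_rays B"
      using s pairwise_orthogonal_codes[OF basis_numbers_subset[of x]] x(2) by (simp add: basis_def)
    moreover have "card (basis_numbers x) = 4"
    proof -
      have "card (basis_numbers x) = length (basis_list x)"
        using distinct_basis_list[OF x(1)] by (metis distinct_card set_basis_list)
      also have "\<dots> = length c" using c(2) by (metis length_map length_sort)
      finally show ?thesis using s by simp
    qed
    then have "card B = 4"
      using ray_inj basis_numbers_subset x(2) unfolding basis_def by (metis card_image inj_on_subset)
    moreover have "B \<subseteq> rays" 
      unfolding x(2) basis_def rays_eq by (rule image_mono[OF basis_numbers_subset])
    ultimately show "B \<in> bases" by (simp add: bases_def)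
  qed
qed

text \<open>Fifteen shifts are the identity on 1..60; this cuts the orbit over all natural
  \<open>k\<close> down to 15 indices.\<close>

lemma basis_numbers_mod: "basis_numbers (l, k mod 15) = basis_numbers (l, k)"
proof -
  have period: "(next_number ^^ 15) n = n" if "n \<in> {1..60}" for n
    by (rule number_eqI) (use funpow_next_number[OF that, of 15] that in
      \<open>simp_all only: mod_add_self2 mod_mod_trivial\<close>)
  have "(next_number ^^ (k mod 15)) n = (next_number ^^ k) n" if "n \<in> generator l" for n
    using period[OF subsetD[OF generator_subset that]] by (rule funpow_mod_eq)
  then show ?thesis by (simp add: basis_numbers_def)
qed

section \<open>Unions of orbits and invariance under \<open>g\<close>\<close>

definition orbits :: "letter set \<Rightarrow> ray set set" where
  "orbits X = basis ` (X \<times> {..<15})"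

lemma orbits_subset: "orbits X \<subseteq> bases"
  by (auto simp: orbits_def bases_eq index_set_def)

lemma orbit_of_eq: "orbit_of l = orbits {l}"
proof -
  have "orbit_of l = (\<lambda>k. basis (l, k)) ` UNIV"
    by (auto simp: orbit_of_def basis_def basis_numbers_def)
  also have "\<dots> = (\<lambda>k. basis (l, k)) ` {..<15}"
  proof -
    have "basis (l, k) = basis (l, k mod 15)" for k by (simp add: basis_def basis_numbers_mod)
    then have "basis (l, k) \<in> (\<lambda>k. basis (l, k)) ` {..<15}" for k
      by (rule image_eqI) simp
    then show ?thesis by blast
  qed
  also have "\<dots> = orbits {l}" by (auto simp: orbits_def)
  finally show ?thesis .
qed

lemma word_eq: "word ls = orbits (set ls)"
  by (auto simp: word_def orbit_of_eq) (auto simp: orbits_def)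

lemma orbits_inj: "inj orbits"
proof (rule injI)
  fix X Y assume "orbits X = orbits Y"
  then have "X \<times> {..<15::nat} = Y \<times> {..<15}"
    using basis_inj unfolding orbits_def index_set_def
    by (subst (asm) inj_on_image_eq_iff) auto
  then have "l \<in> X \<longleftrightarrow> l \<in> Y" for l by (metis mem_Sigma_iff lessThan_iff zero_less_numeral)
  then show "X = Y" by blast
qed

lemma g_basis: "(\<lambda>R. g ` R) ` basis (l, k) = basis (l, Suc k mod 15)"
proof -
  have "(\<lambda>R. g ` R) ` basis (l, k) = ray ` next_number ` basis_numbers (l, k)"
    unfolding basis_def image_image
    by (intro image_cong refl) (simp only: g_eq rot24_ray[OF subsetD[OF basis_numbers_subset]])
  also have "next_number ` basis_numbers (l, k) = basis_numbers (l, Suc k)"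
    by (simp add: basis_numbers_def image_image)
  finally show ?thesis by (simp only: basis_numbers_mod basis_def)
qed

lemma image_Suc_mod: "(\<lambda>k. Suc k mod 15) ` {..<15} = {..<15}"
proof -
  have "k \<in> (\<lambda>k. Suc k mod 15) ` {..<15}" if "k < 15" for k
    using that by (intro image_eqI[of _ _ "(k + 14) mod 15"]) (auto simp: mod_Suc_eq)
  then show ?thesis by auto
qed

lemma fifteen_fold_orbits: "fifteen_fold (orbits X)"
proof -
  have orbits: "orbits X = (\<Union>l\<in>X. (\<lambda>k. basis (l, k)) ` {..<15})"
    by (auto simp: orbits_def)
  have "(\<lambda>B. (\<lambda>R. g ` R) ` B) ` orbits X = (\<Union>l\<in>X. (\<lambda>k. basis (l, k)) ` (\<lambda>k. Suc k mod 15) ` {..<15})"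
    by (simp only: orbits image_UN image_image g_basis)
  also have "\<dots> = orbits X" unfolding image_Suc_mod orbits ..
  finally show ?thesis by (simp add: fifteen_fold_def)
qed

text \<open>\<open>g\<close> raises the index of a basis by 1 modulo 15, so an invariant set
  contains all or none of each orbit. Membership of the generator, index 0, decides which.\<close>

lemma fifteen_fold_imp_orbits:
  assumes "S \<subseteq> bases" "fifteen_fold S"
  obtains X where "S = orbits X"
proof
  have step: "basis (l, Suc k mod 15) \<in> S" if "basis (l, k) \<in> S" for l k
    using assms(2) that unfolding fifteen_fold_def g_basis[symmetric] by blast
  have iter: "basis (l, (k + i) mod 15) \<in> S" if "basis (l, k) \<in> S" "k < 15" for l k i
  proof (induction i)
    case (Suc i)
    then show ?case using step[OF Suc] by (simp add: mod_Suc_eq)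
  qed (use that in simp)
  \<comment> \<open>From index k a shift by 15 - k + j leads to j, whichever of the two is
    larger.\<close>
  have all: "basis (l, j) \<in> S" if "basis (l, k) \<in> S" "k < 15" "j < 15" for l k j
    using iter[OF that(1,2), of "15 - k + j"] that by simp
  show "S = orbits {l. basis (l, 0) \<in> S}"
  proof
    show "S \<subseteq> orbits {l. basis (l, 0) \<in> S}"
    proof
      fix B assume "B \<in> S"
      then obtain l k where "k < 15" "B = basis (l, k)"
        using assms(1) by (auto simp: bases_eq index_set_def)
      then show "B \<in> orbits {l. basis (l, 0) \<in> S}"
        using all[of l k 0] \<open>B \<in> S\<close> by (auto simp: orbits_def)
    qed
    show "orbits {l. basis (l, 0) \<in> S} \<subseteq> S" using all by (auto simp: orbits_def)
  qed
qed

section \<open>Parity\<close>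

lemma occurrences_basis:
  assumes "I \<subseteq> index_set" "n \<in> {1..60}"
  shows "occurrences (basis ` I) (ray n) = card {x \<in> I. n \<in> basis_numbers x}"
proof -
  have "{B \<in> basis ` I. ray n \<in> B} = basis ` {x \<in> I. n \<in> basis_numbers x}"
    using ray_in_basis[OF assms(2)] by auto
  moreover have "inj_on basis {x \<in> I. n \<in> basis_numbers x}"
    using assms(1) by (intro inj_on_subset[OF basis_inj]) auto
  ultimately show ?thesis by (simp add: occurrences_def card_image)
qed

definition ring_count :: "letter \<Rightarrow> nat \<Rightarrow> nat" where
  "ring_count l q = length (filter (\<lambda>m. (m - 1) div 15 = q) (generator_list l))"

lemma ring_count_card: "ring_count l q = card {m \<in> generator l. (m - 1) div 15 = q}"
proof -
  have "distinct (generator_list l)" by (cases l) (simp_all add: generator_list_def)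
  then have "ring_count l q = card (set (filter (\<lambda>m. (m - 1) div 15 = q) (generator_list l)))"
    unfolding ring_count_def by (intro distinct_card[symmetric] distinct_filter)
  then show ?thesis by (simp add: generator_eq_list)
qed

lemma ring_count_simps:
  "ring_count La 0 = 2" "ring_count La 1 = 0" "ring_count La 2 = 0" "ring_count La 3 = 2"
  "ring_count Lb 0 = 0" "ring_count Lb 1 = 2" "ring_count Lb 2 = 2" "ring_count Lb 3 = 0"
  "ring_count Lc 0 = 1" "ring_count Lc 1 = 1" "ring_count Lc 2 = 1" "ring_count Lc 3 = 1"
  "ring_count Ld 0 = 1" "ring_count Ld 1 = 1" "ring_count Ld 2 = 1" "ring_count Ld 3 = 1"
  "ring_count Le 0 = 1" "ring_count Le 1 = 1" "ring_count Le 2 = 1" "ring_count Le 3 = 1"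
  by (simp_all add: ring_count_def generator_list_def)

text \<open>Each generator ray m in the ring of n reaches n at exactly one time \<open>?t m\<close>,
  and different m have different times. So all rays of a ring occur equally often, which reduces
  parity to four numbers per letter.\<close>

lemma card_orbit_occurrences:
  assumes n: "n \<in> {1..60}"
  shows "card {k \<in> {..<15}. n \<in> basis_numbers (l, k)} = ring_count l ((n - 1) div 15)"
proof -
  let ?M = "{m \<in> generator l. (m - 1) div 15 = (n - 1) div 15}"
  let ?t = "\<lambda>m. ((n - 1) mod 15 + 15 - (m - 1) mod 15) mod (15 :: nat)"
  have "k < 15 \<and> n \<in> basis_numbers (l, k) \<longleftrightarrow> k \<in> ?t ` ?M" for k
  proof -
    have "k < 15 \<and> n \<in> basis_numbers (l, k) \<longleftrightarrow> k < 15 \<and> (\<exists>m\<in>generator l. (next_number ^^ k) m = n)"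
      by (auto simp: basis_numbers_def)
    also have "\<dots> \<longleftrightarrow> k < 15 \<and> (\<exists>m\<in>generator l. (m - 1) div 15 = (n - 1) div 15 \<and> k = ?t m)"
      using funpow_next_number_eq_iff[OF _ n, of _ k] generator_subset[of l] by blast
    also have "\<dots> \<longleftrightarrow> k \<in> ?t ` ?M" by auto
    finally show ?thesis .
  qed
  then have "{k \<in> {..<15}. n \<in> basis_numbers (l, k)} = ?t ` ?M" by blast
  moreover have "inj_on ?t ?M"
  proof (rule inj_onI)
    fix m m' assume m: "m \<in> ?M" "m' \<in> ?M" "?t m = ?t m'"
    have cancel: "a = b" if "a < 15" "b < 15" "c < 15" "(c + 15 - a) mod 15 = (c + 15 - b) mod 15" for a b c :: nat
      using that by (auto simp: mod_add_diff split: if_splits)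
    then have "(m - 1) mod 15 = (m' - 1) mod 15" by (intro cancel[OF _ _ _ m(3)]) simp_all
    moreover have "m \<in> {1..60}" "m' \<in> {1..60}" using m generator_subset[of l] by blast+
    moreover have "(m - 1) div 15 = (m' - 1) div 15" using m by simp
    ultimately show "m = m'" by (intro number_eqI[of m m'])
  qed
  ultimately show ?thesis by (simp add: card_image ring_count_card)
qed

lemma finite_letters: "finite (X :: letter set)"
  using List.finite_set[of letters] unfolding set_letters by (rule finite_subset[OF subset_UNIV])

lemma occurrences_orbits:
  assumes "n \<in> {1..60}"
  shows "occurrences (orbits X) (ray n) = (\<Sum>l\<in>X. ring_count l ((n - 1) div 15))"
proof -
  have "{x \<in> X \<times> {..<15}. n \<in> basis_numbers x} = Sigma X (\<lambda>l. {k \<in> {..<15}. n \<in> basis_numbers (l, k)})"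
    by auto
  moreover have "X \<times> {..<15} \<subseteq> index_set" by (auto simp: index_set_def)
  ultimately show ?thesis
    using assms by (simp add: orbits_def occurrences_basis card_SigmaI finite_letters
        card_orbit_occurrences[unfolded lessThan_iff])
qed

lemma card_orbits: "card (orbits X) = 15 * card X"
proof -
  have "inj_on basis (X \<times> {..<15})"
    by (rule inj_on_subset[OF basis_inj]) (auto simp: index_set_def)
  then show ?thesis by (simp add: orbits_def card_image card_cartesian_product)
qed

lemma all_numbers_ring: "(\<forall>n\<in>{1..60}. P ((n - 1) div 15)) \<longleftrightarrow> (\<forall>q<4. P (q :: nat))"
proof
  assume *: "\<forall>n\<in>{1..60}. P ((n - 1) div (15 :: nat))"
  show "\<forall>q<4. P q"
  proof (intro allI impI)
    fix q :: nat assume "q < 4"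
    then show "P q" using bspec[OF *, of "15 * q + 1"] by simp
  qed
qed (use ring_less_4 in blast)

lemma parity_proof_orbits:
  "parity_proof (orbits X) \<longleftrightarrow> odd (card X) \<and> (\<forall>q<4. even (\<Sum>l\<in>X. ring_count l q))"
  unfolding parity_proof_def all_numbers_ring[symmetric]
  by (auto simp: orbits_subset card_orbits rays_eq occurrences_orbits)

lemma all_letters: "(\<forall>l. P l) \<longleftrightarrow> P La \<and> P Lb \<and> P Lc \<and> P Ld \<and> P Le"
  by (metis letter.exhaust)

lemma sum_letters:
  "(\<Sum>l\<in>X. f l) = (\<Sum>l\<leftarrow>letters. if l \<in> X then f l else (0 :: nat))"
proof -
  have "(\<Sum>l\<in>X. f l) = (\<Sum>l\<in>set letters. if l \<in> X then f l else 0)"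
    by (simp add: set_letters sum.If_cases finite_letters)
  then show ?thesis by (simp add: sum.distinct_set_conv_list letters_def)
qed

lemma parity_letter_sets:
  "odd (card X) \<and> (\<forall>q<4. even (\<Sum>l\<in>X. ring_count l q)) \<longleftrightarrow>
     X \<in> {{La}, {Lb}, {La, Lc, Ld}, {La, Lc, Le}, {La, Ld, Le}, {Lb, Lc, Ld}, {Lb, Lc, Le}, {Lb, Ld, Le}}"
proof -
  \<comment> \<open>Written as a sum of ones, the cardinality falls under \<open>sum_letters\<close>
    too.\<close>
  have card: "card X = (\<Sum>l\<in>X. 1)" by simp
  show ?thesis
    unfolding all_less_4 card sum_letters letters_def
    unfolding insert_iff empty_iff set_eq_iff all_letters
    \<comment> \<open>All 32 sets of letters are checked. The rules are given in two forms because
      simplification turns 1 into \<open>Suc 0\<close>.\<close>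
    by (cases "La \<in> X"; cases "Lb \<in> X"; cases "Lc \<in> X"; cases "Ld \<in> X"; cases "Le \<in> X")
       (simp_all add: ring_count_simps ring_count_simps[unfolded One_nat_def])
qed

text \<open>Occurrences are constant on each ring of 15 rays, so a count of rays is 15 times a count
  of rings.\<close>

lemma card_rays_ring:
  "card {R \<in> rays. occurrences (orbits X) R = m} =
     15 * count_list (map (\<lambda>q. \<Sum>l\<in>X. ring_count l q) [0, 1, 2, 3]) m"
proof -
  let ?Q = "set (filter (\<lambda>q. (\<Sum>l\<in>X. ring_count l q) = m) [0, 1, 2, 3])"
  let ?N = "{n \<in> {1..60}. (\<Sum>l\<in>X. ring_count l ((n - 1) div 15)) = m}"
  have "{R \<in> rays. occurrences (orbits X) R = m} = ray ` ?N"
    by (auto simp: rays_eq occurrences_orbits)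
  moreover have "inj_on ray ?N" by (rule inj_on_subset[OF ray_inj]) blast
  ultimately have "card {R \<in> rays. occurrences (orbits X) R = m} = card ?N"
    by (simp only: card_image)
  also have "?N = (\<lambda>(q, k). 15 * q + k + 1) ` (?Q \<times> {..<15})"
  proof
    show "?N \<subseteq> (\<lambda>(q, k). 15 * q + k + 1) ` (?Q \<times> {..<15})"
    proof
      fix n assume n: "n \<in> ?N"
      then have "(n - 1) div 15 \<in> {0, 1, 2, 3}" using ring_less_4[of n] by auto
      then have "((n - 1) div 15, (n - 1) mod 15) \<in> ?Q \<times> {..<15}" using n by auto
      then show "n \<in> (\<lambda>(q, k). 15 * q + k + 1) ` (?Q \<times> {..<15})"
        using n by (intro image_eqI[of _ _ "((n - 1) div 15, (n - 1) mod 15)"]) auto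
    qed
    show "(\<lambda>(q, k). 15 * q + k + 1) ` (?Q \<times> {..<15}) \<subseteq> ?N"
    proof
      fix n assume "n \<in> (\<lambda>(q, k). 15 * q + k + 1) ` (?Q \<times> {..<15})"
      then obtain x where x: "n = (\<lambda>(q, k). 15 * q + k + 1) x" "x \<in> ?Q \<times> {..<15}"
        by (rule imageE)
      obtain q k where qk: "x = (q, k)" by (cases x)
      have n: "n = 15 * q + k + 1" using x(1) unfolding qk by (simp only: split)
      have "q \<in> ?Q" "k < 15" using x(2) unfolding qk by (simp_all only: mem_Sigma_iff lessThan_iff)
      then have q: "q \<in> {0, 1, 2, 3}" "(\<Sum>l\<in>X. ring_count l q) = m" and k: "k < 15"
        unfolding set_filter by auto
      have "(15 * q + k + 1 - 1) div 15 = q" using k by simp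
      moreover have "15 * q + k + 1 \<in> {1..60}" using q(1) k by auto
      ultimately show "n \<in> ?N" unfolding n using q(2) by (simp only: mem_Collect_eq simp_thms)
    qed
  qed
  also have "card \<dots> = card (?Q \<times> {..<15::nat})"
    by (rule card_image, rule inj_on_inverseI[where g = "\<lambda>n. ((n - 1) div 15, (n - 1) mod 15)"])
      (auto simp del: filter.simps set_filter)
  also have "\<dots> = 15 * card ?Q" by (simp only: card_cartesian_product card_lessThan mult.commute)
  also have "card ?Q = length (filter (\<lambda>q. (\<Sum>l\<in>X. ring_count l q) = m) [0, 1, 2, 3])"
    by (rule distinct_card) simp
  also have "\<dots> = count_list (map (\<lambda>q. \<Sum>l\<in>X. ring_count l q) [0, 1, 2, 3]) m"
    by simp
  finally show ?thesis .
qed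

text \<open>Entries of a symbol are positive, so for the empty set of letters the second component
  would be empty.\<close>

lemma symbol_orbits:
  assumes "X \<noteq> {}"
  shows "ray_basis_symbol (orbits X) =
    ({(p, m). 0 < p \<and> 0 < m \<and> p = 15 * count_list (map (\<lambda>q. \<Sum>l\<in>X. ring_count l q) [0, 1, 2, 3]) m},
     {(15 * card X, 4)})"
proof -
  have "{B \<in> orbits X. card B = k} = (if k = 4 then orbits X else {})" for k
    using orbits_subset[of X] by (auto simp: bases_def)
  moreover have "0 < card X" using assms finite_letters by (simp add: card_gt_0_iff)
  ultimately show ?thesis
    unfolding ray_basis_symbol_def card_rays_ring by (auto simp: card_orbits)
qed

text \<open>If T had basis k but not basis k + d, their shared ray would occur exactly once. Hence
  the indices of T are closed under adding \<open>d\<close>; as \<open>d\<close> is invertible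
  modulo 15 and T is nonempty by oddness, T is the whole orbit.\<close>

lemma irreducible_orbit:
  assumes parity: "parity_proof (orbits {l})"
    and inverse: "d * e mod 15 = 1"
    and shared: "\<And>k. k < 15 \<Longrightarrow> \<exists>n\<in>{1..60}. {j \<in> {..<15}. n \<in> basis_numbers (l, j)} = {k, (k + d) mod 15}"
  shows "irreducible_proof (orbits {l})"
  unfolding irreducible_proof_def
proof (intro conjI notI parity)
  assume "\<exists>T. T \<subset> orbits {l} \<and> parity_proof T"
  then obtain T where T: "T \<subset> orbits {l}" "parity_proof T" by blast
  define K where "K = {k \<in> {..<15}. basis (l, k) \<in> T}"
  have TK: "T = basis ` ({l} \<times> K)" using T(1) by (auto simp: K_def orbits_def)
  have K: "{l} \<times> K \<subseteq> index_set" by (auto simp: K_def index_set_def)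
  have "(k + d) mod 15 \<in> K" if k: "k \<in> K" for k
  proof (rule ccontr)
    assume notin: "(k + d) mod 15 \<notin> K"
    have "k < 15" using k by (simp add: K_def)
    then obtain n where n: "n \<in> {1..60}" "{j \<in> {..<15}. n \<in> basis_numbers (l, j)} = {k, (k + d) mod 15}"
      using shared by blast
    have "{x \<in> {l} \<times> K. n \<in> basis_numbers x} = {l} \<times> (K \<inter> {j \<in> {..<15}. n \<in> basis_numbers (l, j)})"
      by (auto simp: K_def)
    also have "\<dots> = {(l, k)}" unfolding n(2) using k notin by auto
    finally have "occurrences T (ray n) = 1"
      using occurrences_basis[OF K n(1)] by (simp add: TK)
    moreover have "even (occurrences T (ray n))" using T(2) n(1) by (auto simp: parity_proof_def rays_eq)
    ultimately show False by simp
  qed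
  then have step: "(k + d * i) mod 15 \<in> K" if "k \<in> K" for k i
  proof (induction i)
    case (Suc i)
    have "(k + d * Suc i) mod 15 = ((k + d * i) mod 15 + d) mod 15"
      by (simp only: mod_add_left_eq mult_Suc_right) (simp only: ac_simps)
    then show ?case using Suc by simp
  qed (use that in \<open>simp add: K_def\<close>)
  have all: "j \<in> K" if "k \<in> K" "j < 15" for j k
  proof -
    have "d * (e * t) mod 15 = t mod 15" for t
      using mod_mult_left_eq[of "d * e" 15 t] by (simp add: inverse mult.assoc)
    \<comment> \<open>The number of steps that leads from k to j is the difference j - k modulo 15
      multiplied by the inverse \<open>e\<close>.\<close>
    then have "(k + d * (e * (j + 15 - k))) mod 15 = (k + (j + 15 - k)) mod 15"
      by (rule mod_add_cong[OF refl])
    also have "\<dots> = (j + 15) mod 15" using that by (simp add: K_def del: mod_add_self2)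
    also have "\<dots> = j" using that by simp
    finally show ?thesis using step[OF that(1)] by metis
  qed
  have "odd (card T)" using T(2) by (simp add: parity_proof_def)
  then have "K \<noteq> {}" using TK by auto
  then have "K = {..<15}" using all by (auto simp: K_def)
  then show False using T(1) TK by (simp add: orbits_def)
qed

text \<open>The witness is \<open>m'\<close> shifted k times. It lies in basis k through
  \<open>m'\<close> and in basis k + d through \<open>m\<close>, which is d places behind in the
  same ring; no other generator ray is in that ring.\<close>

lemma shared_ray:
  assumes "m \<in> generator l" "m' \<in> generator l" "(m - 1) div 15 = (m' - 1) div 15"
    and others: "\<And>x. x \<in> generator l \<Longrightarrow> (x - 1) div 15 = (m - 1) div 15 \<Longrightarrow> x = m \<or> x = m'"
    and "m' = m + d" "k < 15"
  shows "\<exists>n\<in>{1..60}. {j \<in> {..<15}. n \<in> basis_numbers (l, j)} = {k, (k + d) mod 15}"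
proof
  let ?n = "(next_number ^^ k) m'"
  have m: "m \<in> {1..60}" "m' \<in> {1..60}" using assms generator_subset by blast+
  note n = funpow_next_number[OF m(2), of k]
  define t where "t x = (((m' - 1) mod 15 + k) mod 15 + 15 - (x - 1) mod 15) mod 15" for x
  show "?n \<in> {1..60}" by (rule n)
  have "j < 15 \<and> ?n \<in> basis_numbers (l, j) \<longleftrightarrow> j = k \<or> j = (k + d) mod 15" for j
  proof -
    have eq: "(next_number ^^ j) x = ?n \<longleftrightarrow> (x - 1) div 15 = (m - 1) div 15 \<and>
       j = t x" if "x \<in> generator l" "j < 15" for x
      using funpow_next_number_eq_iff[OF subsetD[OF generator_subset that(1)] n(1) that(2)]
      unfolding n(2,3) assms(3)[symmetric] t_def .
    \<comment> \<open>Within one ring there is no wraparound between \<open>m\<close> and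
      \<open>m'\<close>, so their positions differ by exactly \<open>d\<close>.\<close>
    have ring: "(a + d) div 15 = a div 15 \<Longrightarrow> (a + d) mod 15 = a mod 15 + d" for a
      by (metis add_diff_cancel_left' add.assoc div_mult_mod_eq mult_div_mod_eq)
    have "m' - 1 = (m - 1) + d" using m assms(5) by simp
    then have r: "(m' - 1) mod 15 = (m - 1) mod 15 + d" using ring[of "m - 1"] assms(3) by simp
    have "(m' - 1) mod 15 < 15" by simp
    then have a1: "k = t m'" unfolding t_def
      using assms(6) by (intro iffD1[OF add_mod_eq_iff]) simp_all
    have a2: "(k + d) mod 15 = t m" unfolding t_def
    proof (rule iffD1[OF add_mod_eq_iff])
      show "((m - 1) mod 15 + (k + d) mod 15) mod 15 = ((m' - 1) mod 15 + k) mod 15"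
        unfolding r mod_add_right_eq by (simp only: ac_simps)
    qed simp_all
    have "j < 15 \<and> ?n \<in> basis_numbers (l, j) \<longleftrightarrow> j < 15 \<and> (\<exists>x\<in>generator l. (next_number ^^ j) x = ?n)"
      by (auto simp: basis_numbers_def intro: rev_image_eqI)
    also have "\<dots> \<longleftrightarrow> j < 15 \<and> (\<exists>x\<in>{m, m'}. j = t x)"
    proof (intro conj_cong refl iffI)
      assume "j < 15" "\<exists>x\<in>generator l. (next_number ^^ j) x = ?n"
      then obtain x where x: "x \<in> generator l" "(next_number ^^ j) x = ?n" by blast
      with eq[OF x(1) \<open>j < 15\<close>] have "(x - 1) div 15 = (m - 1) div 15" "j = t x" by blast+
      with others[OF x(1)] show "\<exists>x\<in>{m, m'}. j = t x" by blast
    next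
      assume "j < 15" "\<exists>x\<in>{m, m'}. j = t x"
      then show "\<exists>x\<in>generator l. (next_number ^^ j) x = ?n"
        using eq[OF assms(1)] eq[OF assms(2)] assms(1-3) by (metis insertE empty_iff)
    qed
    also have "\<dots> \<longleftrightarrow> j = k \<or> j = (k + d) mod 15" using assms(6) by (simp flip: a1 a2) auto
    finally show ?thesis .
  qed
  then show "{j \<in> {..<15}. ?n \<in> basis_numbers (l, j)} = {k, (k + d) mod 15}" by blast
qed

lemma irreducible_words: "irreducible_proof (orbits {La})" "irreducible_proof (orbits {Lb})"
proof -
  have "parity_proof (orbits {La})" "parity_proof (orbits {Lb})"
    unfolding parity_proof_orbits parity_letter_sets by simp_all
  note parity = this
  show "irreducible_proof (orbits {La})"
  \<comment> \<open>Rays 1 and 5 are four apart in ring A, and 4 is its own inverse modulo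
    15.\<close>
  proof (rule irreducible_orbit[of La 4 4, OF parity(1)])
    show "\<exists>n\<in>{1..60}. {j \<in> {..<15}. n \<in> basis_numbers (La, j)} = {k, (k + 4) mod 15}"
      if "k < 15" for k
      by (rule shared_ray[of 1 La 5]) (use that in auto)
  qed simp
  show "irreducible_proof (orbits {Lb})"
  \<comment> \<open>Rays 16 and 18 are two apart in ring B, and 2 * 8 = 16.\<close>
  proof (rule irreducible_orbit[of Lb 2 8, OF parity(2)])
    show "\<exists>n\<in>{1..60}. {j \<in> {..<15}. n \<in> basis_numbers (Lb, j)} = {k, (k + 2) mod 15}"
      if "k < 15" for k
      by (rule shared_ray[of 16 Lb 18]) (use that in auto)
  qed simp
qed

lemma symbol_entries_2:
  "xs \<in> {[2, 0, 0, 2], [0, 2, 2, 0]} \<Longrightarrow>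
     {(p, m). 0 < p \<and> 0 < m \<and> p = 15 * count_list xs m} = {(30, 2 :: nat)}"
  by (auto split: if_splits)

lemma symbol_entries_2_4:
  "xs \<in> {[4, 2, 2, 4], [2, 4, 4, 2]} \<Longrightarrow>
     {(p, m). 0 < p \<and> 0 < m \<and> p = 15 * count_list xs m} = {(30, 2 :: nat), (30, 4)}"
  by (auto split: if_splits)

lemma reducible_orbits:
  assumes "parity_proof (orbits X)" "Y \<subset> X" "parity_proof (orbits Y)"
  shows "reducible_proof (orbits X)"
proof -
  have "orbits Y \<subset> orbits X"
    using assms(2) injD[OF orbits_inj, of Y X] by (auto simp: orbits_def)
  then show ?thesis using assms by (auto simp: reducible_proof_def irreducible_proof_def)
qed

lemma fifteen_fold_parity_proofs:
  "{S. parity_proof S \<and> fifteen_fold S} =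
     orbits ` {{La}, {Lb}, {La, Lc, Ld}, {La, Lc, Le}, {La, Ld, Le}, {Lb, Lc, Ld}, {Lb, Lc, Le}, {Lb, Ld, Le}}"
  (is "?L = orbits ` ?W")
proof
  show "?L \<subseteq> orbits ` ?W"
  proof
    fix S assume S: "S \<in> ?L"
    then obtain X where X: "S = orbits X"
      by (auto simp: parity_proof_def elim: fifteen_fold_imp_orbits)
    then have "parity_proof (orbits X)" using S by simp
    then have "X \<in> ?W" unfolding parity_proof_orbits parity_letter_sets .
    with X show "S \<in> orbits ` ?W" by (rule image_eqI)
  qed
  show "orbits ` ?W \<subseteq> ?L"
  proof
    fix S assume "S \<in> orbits ` ?W"
    then obtain X where "X \<in> ?W" "S = orbits X" by (rule imageE)
    then show "S \<in> ?L"
      using fifteen_fold_orbits unfolding mem_Collect_eq parity_letter_sets[symmetric] parity_proof_orbits[symmetric]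
      by simp
  qed
qed

theorem mainTheorem3:
  shows "{S. parity_proof S \<and> fifteen_fold S} =
           {word [La], word [Lb],
            word [La, Lc, Ld], word [La, Lc, Le], word [La, Ld, Le],
            word [Lb, Lc, Ld], word [Lb, Lc, Le], word [Lb, Ld, Le]}
       \<and> card {S. parity_proof S \<and> fifteen_fold S} = 8
       \<and> (\<forall>S \<in> {word [La], word [Lb]}.
            ray_basis_symbol S = ({(30, 2)}, {(15, 4)}) \<and> irreducible_proof S)
       \<and> (\<forall>S \<in> {word [La, Lc, Ld], word [La, Lc, Le], word [La, Ld, Le],
                 word [Lb, Lc, Ld], word [Lb, Lc, Le], word [Lb, Ld, Le]}.
            ray_basis_symbol S = ({(30, 2), (30, 4)}, {(45, 4)}) \<and> reducible_proof S)"
proof (intro conjI)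
  let ?W = "{{La}, {Lb}, {La, Lc, Ld}, {La, Lc, Le}, {La, Ld, Le}, {Lb, Lc, Ld}, {Lb, Lc, Le}, {Lb, Ld, Le}}"
  show "{S. parity_proof S \<and> fifteen_fold S} =
           {word [La], word [Lb],
            word [La, Lc, Ld], word [La, Lc, Le], word [La, Ld, Le],
            word [Lb, Lc, Ld], word [Lb, Lc, Le], word [Lb, Ld, Le]}"
    unfolding fifteen_fold_parity_proofs word_eq by simp
  \<comment> \<open>The eight sets are told apart letter by letter.\<close>
  have "card ?W = 8"
    by (simp add: set_eq_iff all_letters)
  then show "card {S. parity_proof S \<and> fifteen_fold S} = 8"
    unfolding fifteen_fold_parity_proofs using orbits_inj
    by (simp only: card_image[OF inj_on_subset[OF orbits_inj subset_UNIV]])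
  have parity: "parity_proof (orbits X)" if "X \<in> ?W" for X
    using that unfolding parity_proof_orbits parity_letter_sets .
  show "\<forall>S \<in> {word [La], word [Lb]}.
            ray_basis_symbol S = ({(30, 2)}, {(15, 4)}) \<and> irreducible_proof S"
  proof -
    have "ray_basis_symbol (orbits X) = ({(30, 2)}, {(15, 4)})" if X: "X \<in> {{La}, {Lb}}" for X
    proof -
      have "map (\<lambda>q. \<Sum>l\<in>X. ring_count l q) [0, 1, 2, 3] \<in> {[2, 0, 0, 2], [0, 2, 2, 0]}"
        and ne: "X \<noteq> {}" and "card X = 1"
        using X by (auto simp: ring_count_simps ring_count_simps[unfolded One_nat_def])
      then show ?thesis
        unfolding symbol_orbits[OF ne] by (simp only: symbol_entries_2) simp
    qed
    then show ?thesis using irreducible_words by (simp add: word_eq)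
  qed
  show "\<forall>S \<in> {word [La, Lc, Ld], word [La, Lc, Le], word [La, Ld, Le],
                 word [Lb, Lc, Ld], word [Lb, Lc, Le], word [Lb, Ld, Le]}.
            ray_basis_symbol S = ({(30, 2), (30, 4)}, {(45, 4)}) \<and> reducible_proof S"
  proof -
    have "ray_basis_symbol (orbits X) = ({(30, 2), (30, 4)}, {(45, 4)}) \<and> reducible_proof (orbits X)"
      if "X \<in> {{La, Lc, Ld}, {La, Lc, Le}, {La, Ld, Le}, {Lb, Lc, Ld}, {Lb, Lc, Le}, {Lb, Ld, Le}}" for X
    proof
      show "ray_basis_symbol (orbits X) = ({(30, 2), (30, 4)}, {(45, 4)})"
      proof -
        \<comment> \<open>Each of c, d, e adds 1 in every ring, so two of them raise the numbers of
          a or b by 2.\<close>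
        have "map (\<lambda>q. \<Sum>l\<in>X. ring_count l q) [0, 1, 2, 3] \<in> {[4, 2, 2, 4], [2, 4, 4, 2]}"
          and ne: "X \<noteq> {}" and "card X = 3"
          using that by (auto simp: ring_count_simps ring_count_simps[unfolded One_nat_def])
        then show ?thesis
          unfolding symbol_orbits[OF ne] by (simp only: symbol_entries_2_4) simp
      qed
      have "{La} \<subset> X \<or> {Lb} \<subset> X" using that by auto
      then show "reducible_proof (orbits X)"
        using reducible_orbits[of X] parity that by blast
    qed
    then show ?thesis by (simp add: word_eq)
  qed
qed

end
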